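(* Let $(G,\sim,\mathcal{R})$ be a framed turbulence chart. Any nonnegative flow on $(G,\sim)$ has at most one representation as a positive bundle combination. A dense subset of $\mathcal F_{\geq0}(G,\sim)$, including all rational nonnegative flows, is obtained as bundle combinations. If $F\in\mathcal F_{\geq0}(G,\sim)$ is an integer flow, then its bundle combination has integral coefficients.
   Context: All graphs are finite undirected graphs (loops and multiple edges allowed) in which every vertex is incident to at least one edge. A vertex is fringe if it is incident to exactly one edge (a loop counts twice) and internal otherwise; an edge is fringe if incident to a fringe vertex. A half-edge is a pair $(e,v)$ with $v$ an endpoint of $e$; every edge has exactly two half-edges. A turbulence chart $(G,\sim)$ is such a graph $G$ (edge set $E$) with, for every internal vertex $v$, an equivalence relation $\sim_v$ on the half-edges at $v$ with exactly two nonempty classes. A flow is $F:E\to\mathbb R$ such that at every internal vertex $v$ the sum of $F(e)$ over half-edges $(e,v)$ in one class of $\sim_v$ equals that over the other class; nonnegative if $F\ge0$. $\mathcal F_{\geq0}(G,\sim)$ is the cone of nonnegative flows. The strength of a flow is $\frac12\sum_{e \text{ fringe}}F(e)$. An oriented edge is an ordering $\tilde e=e^te^h$ of the two half-edges of an edge $e$, from the vertex $t(\tilde e)$ of $e^t$ to the vertex $h(\tilde e)$ of $e^h$; $\tilde e^{-1}=e^he^t$. A string is a sequence $\tilde e_1\cdots\tilde e_m$ of oriented edges with $h(\tilde e_j)=t(\tilde e_{j+1})$ and $e_j^h,e_{j+1}^t$ in different classes of $\sim_{h(\tilde e_j)}$; there are also lazy strings of length $0$ at each vertex; substrings are contiguous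 pieces (including lazy ones). A route is a string starting and ending at fringe vertices, identified with its inverse. A band is a string $B$ with $BB$ a string and $B$ not a proper power of a shorter string; its substrings are substrings of its powers; bands are identified up to rotation and inversion. A trail is a route or band; $\mathcal I(p)\in\mathbb R^E$ counts how often trail $p$ traverses each edge. A framing $\mathcal R$ assigns a linear order to each class of each $\sim_v$. An incompatibility is a pair $(\tilde e_1 s\tilde f_1,\tilde e_2 s\tilde f_2)$ where $\tilde e_1,\tilde e_2$ end at an internal vertex $v$ with heads in the same class and $\tilde e_1^h<_{\mathcal R}\tilde e_2^h$, $\tilde f_1,\tilde f_2$ start at an internal vertex $w$ with tails in the same class and $\tilde f_1^t<_{\mathcal R}\tilde f_2^t$, and $s$ is a (possibly lazy) string with $\tilde e_1 s\tilde f_1$ a string. Trails $p,q$ are incompatible if (after possibly swapping) substrings $p'$ of $p^{\pm1}$ and $q'$ of $q^{\pm1}$ form an incompatibility $(p',q')$; otherwise compatible. A bundle is a set of pairwise compatible trails (each trail compatible with itself), up to equivalence of trails; write $\bar{\mathcal K}=\mathcal K\cup\mathcal B$ with $\mathcal K$ its routes and $\mathcal B$ its bands. A $\bar{\mathcal K}$-bundle combination is a vector $F=\sum_{p\in\bar{\mathcal K}}a_p\mathcal I(p)$ with all $a_p\ge0$; a bundle combination is a $\bar{\mathcal K}$-bundle combination for some bundle $\bar{\mathcal K}$; it is positive if all $a_p>0$. *)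

theory Defs
  imports "HOL-Analysis.Analysis" "HOL-Library.Sublist"
begin

section \<open>Turbulence charts and flows\<close>

text \<open>
  The two half-edges of an edge \<open>e\<close> are \<open>(e, False)\<close> and \<open>(e, True)\<close>, in no preferred order;
  \<open>vertex_of\<close> sends a half-edge to its endpoint, so that \<open>e\<close> is a loop iff its two half-edges are
  sent to the same vertex.  \<open>vsim G v\<close> is the equivalence relation \<open>\<sim>\<^sub>v\<close>; it is only meaningful at
  internal vertices.
\<close>

type_synonym 'e half_edge = "'e \<times> bool"

record ('v, 'e) chart =
  verts :: "'v set"
  edges :: "'e set"
  vertex_of :: "'e half_edge \<Rightarrow> 'v"
  vsim :: "'v \<Rightarrow> 'e half_edge rel"

definition half_edges :: "('v, 'e) chart \<Rightarrow> 'e half_edge set" where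
  "half_edges G = edges G \<times> UNIV"

definition half_edges_at :: "('v, 'e) chart \<Rightarrow> 'v \<Rightarrow> 'e half_edge set" where
  "half_edges_at G v = {h \<in> half_edges G. vertex_of G h = v}"

definition fringe_vertex :: "('v, 'e) chart \<Rightarrow> 'v \<Rightarrow> bool" where
  "fringe_vertex G v \<longleftrightarrow> v \<in> verts G \<and> card (half_edges_at G v) = 1"

definition internal_vertex :: "('v, 'e) chart \<Rightarrow> 'v \<Rightarrow> bool" where
  "internal_vertex G v \<longleftrightarrow> v \<in> verts G \<and> \<not> fringe_vertex G v"

definition vclasses :: "('v, 'e) chart \<Rightarrow> 'v \<Rightarrow> 'e half_edge set set" where
  "vclasses G v = half_edges_at G v // vsim G v"

definition turbulence_chart :: "('v, 'e) chart \<Rightarrow> bool" where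
  "turbulence_chart G \<longleftrightarrow>
     finite (verts G) \<and> finite (edges G) \<and>
     vertex_of G ` half_edges G \<subseteq> verts G \<and>
     (\<forall>v \<in> verts G. half_edges_at G v \<noteq> {}) \<and>
     (\<forall>v. internal_vertex G v \<longrightarrow>
        equiv (half_edges_at G v) (vsim G v) \<and> card (vclasses G v) = 2)"

text \<open>
  Elements of \<open>\<real>\<^sup>E\<close> are the functions on the type of edges that vanish outside the finite set of
  edges, with the topology of pointwise convergence.
\<close>

definition flow :: "('v, 'e) chart \<Rightarrow> ('e \<Rightarrow> real) \<Rightarrow> bool" where
  "flow G F \<longleftrightarrow>
     (\<forall>e. e \<notin> edges G \<longrightarrow> F e = 0) \<and>
     (\<forall>v. internal_vertex G v \<longrightarrow>
        (\<forall>A \<in> vclasses G v. \<forall>B \<in> vclasses G v. (\<Sum>h\<in>A. F (fst h)) = (\<Sum>h\<in>B. F (fst h))))"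

definition nonneg_flows :: "('v, 'e) chart \<Rightarrow> ('e \<Rightarrow> real) set" where
  "nonneg_flows G = {F. flow G F \<and> (\<forall>e \<in> edges G. 0 \<le> F e)}"


section \<open>Strings and trails\<close>

text \<open>
  An oriented edge is identified with the half-edge at its tail, so that the head half-edge of
  \<open>\<alpha>\<close> is the other half of the same edge, and this is at the same time the inverse of \<open>\<alpha>\<close>.
\<close>

type_synonym 'e oriented_edge = "'e half_edge"

definition other_half :: "'e half_edge \<Rightarrow> 'e half_edge" where
  "other_half h = (fst h, \<not> snd h)"

abbreviation tail_half :: "'e oriented_edge \<Rightarrow> 'e half_edge" where
  "tail_half \<alpha> \<equiv> \<alpha>"

abbreviation head_half :: "'e oriented_edge \<Rightarrow> 'e half_edge" where
  "head_half \<alpha> \<equiv> other_half \<alpha>"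

abbreviation inv_oriented :: "'e oriented_edge \<Rightarrow> 'e oriented_edge" where
  "inv_oriented \<alpha> \<equiv> other_half \<alpha>"

definition composable :: "('v, 'e) chart \<Rightarrow> 'e oriented_edge \<Rightarrow> 'e oriented_edge \<Rightarrow> bool" where
  "composable G \<alpha> \<beta> \<longleftrightarrow>
     (\<exists>v. internal_vertex G v \<and> vertex_of G (head_half \<alpha>) = v \<and> vertex_of G (tail_half \<beta>) = v \<and>
          (head_half \<alpha>, tail_half \<beta>) \<notin> vsim G v)"

text \<open>
  The empty list stands for the lazy string at every vertex: where a lazy string occurs below, its
  vertex is determined by the neighbouring oriented edges.
\<close>

definition is_string :: "('v, 'e) chart \<Rightarrow> 'e oriented_edge list \<Rightarrow> bool" where
  "is_string G s \<longleftrightarrow> set s \<subseteq> half_edges G \<and> successively (composable G) s"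

definition inv_string :: "'e oriented_edge list \<Rightarrow> 'e oriented_edge list" where
  "inv_string s = rev (map inv_oriented s)"

text \<open>
  Lazy strings at fringe vertices do not count as routes; they would have zero indicator vector.
\<close>

definition is_route :: "('v, 'e) chart \<Rightarrow> 'e oriented_edge list \<Rightarrow> bool" where
  "is_route G p \<longleftrightarrow> is_string G p \<and> p \<noteq> [] \<and>
     fringe_vertex G (vertex_of G (tail_half (hd p))) \<and>
     fringe_vertex G (vertex_of G (head_half (last p)))"

definition string_power :: "'a list \<Rightarrow> nat \<Rightarrow> 'a list" where
  "string_power B k = concat (replicate k B)"

definition is_band :: "('v, 'e) chart \<Rightarrow> 'e oriented_edge list \<Rightarrow> bool" where
  "is_band G B \<longleftrightarrow> B \<noteq> [] \<and> is_string G (B @ B) \<and>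
     \<not> (\<exists>s k. k \<ge> 2 \<and> is_string G s \<and> B = string_power s k)"

text \<open>Trails are equivalence classes of words: the words that represent one and the same trail.\<close>

type_synonym 'e trail = "'e oriented_edge list set"

definition routes :: "('v, 'e) chart \<Rightarrow> 'e trail set" where
  "routes G = {{p, inv_string p} | p. is_route G p}"

definition bands :: "('v, 'e) chart \<Rightarrow> 'e trail set" where
  "bands G = {{rotate n B | n. True} \<union> {rotate n (inv_string B) | n. True} | B. is_band G B}"

definition trails :: "('v, 'e) chart \<Rightarrow> 'e trail set" where
  "trails G = routes G \<union> bands G"

text \<open>
  The substrings of all representatives of \<open>T\<close>, that is of \<open>p\<close> and its inverse if \<open>p\<close> represents \<open>T\<close>.
\<close>

definition substrings :: "('v, 'e) chart \<Rightarrow> 'e trail \<Rightarrow> 'e oriented_edge list set" where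
  "substrings G T =
     {s. \<exists>p \<in> T. (is_route G p \<and> sublist s p) \<or>
                 (is_band G p \<and> (\<exists>k. sublist s (string_power p k)))}"

text \<open>The number of traversals does not depend on the representative, see below.\<close>

definition trail_vec :: "'e trail \<Rightarrow> 'e \<Rightarrow> real" where
  "trail_vec T e = real (count_list (map fst (SOME p. p \<in> T)) e)"

lemma trail_vec_eq:
  fixes G :: "('v, 'e) chart"
  assumes "T \<in> trails G" and "p \<in> T"
  shows "trail_vec T e = real (count_list (map fst p) e)"
proof -
  have inv: "mset (map fst (inv_string q)) = mset (map fst q)" for q :: "'e oriented_edge list"
    by (simp add: inv_string_def other_half_def o_def rev_map [symmetric] flip: mset_map)
  have "mset (rotate n q) = mset q" for n and q :: "'e oriented_edge list"
  proof (induction n)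
    case (Suc n)
    then show ?case
      by (cases "rotate n q") simp_all
  qed simp
  then have rot: "mset (map fst (rotate n q)) = mset (map fst q)"
    for n and q :: "'e oriented_edge list"
    by simp
  from assms(1) obtain B :: "'e oriented_edge list"
    where B: "\<forall>q \<in> T. mset (map fst q) = mset (map fst B)"
    unfolding trails_def
  proof
    assume "T \<in> routes G"
    then obtain B where "T = {B, inv_string B}"
      unfolding routes_def by blast
    then show thesis
      by (intro that [of B]) (auto simp: inv simp del: mset_map)
  next
    assume "T \<in> bands G"
    then obtain B where T: "T = {rotate n B | n. True} \<union> {rotate n (inv_string B) | n. True}"
      unfolding bands_def by blast
    have "mset (map fst q) = mset (map fst B)" if "q \<in> T" for q
    proof -
      from that T obtain n where "q = rotate n B \<or> q = rotate n (inv_string B)"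
        by blast
      then show ?thesis
        using rot inv by (elim disjE) (simp_all del: mset_map)
    qed
    then show thesis
      by (intro that [of B]) blast
  qed
  have "(SOME q. q \<in> T) \<in> T"
    using assms(2) by (rule someI)
  then have "mset (map fst (SOME q. q \<in> T)) = mset (map fst p)"
    using B [rule_format, OF assms(2)] B [rule_format] by (simp del: mset_map)
  then show ?thesis
    by (simp add: trail_vec_def del: mset_map flip: count_mset)
qed


section \<open>Framings and bundles\<close>

text \<open>A framing assigns to every class (as a set of half-edges) a reflexive linear order on it.\<close>

definition framing :: "('v, 'e) chart \<Rightarrow> ('e half_edge set \<Rightarrow> 'e half_edge rel) \<Rightarrow> bool" where
  "framing G R \<longleftrightarrow>
     (\<forall>v. internal_vertex G v \<longrightarrow> (\<forall>C \<in> vclasses G v. linear_order_on C (R C)))"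

definition frame_less ::
    "('v, 'e) chart \<Rightarrow> ('e half_edge set \<Rightarrow> 'e half_edge rel) \<Rightarrow>
     'e half_edge \<Rightarrow> 'e half_edge \<Rightarrow> bool" where
  "frame_less G R h\<^sub>1 h\<^sub>2 \<longleftrightarrow>
     (\<exists>v. internal_vertex G v \<and>
        (\<exists>C \<in> vclasses G v. h\<^sub>1 \<in> C \<and> h\<^sub>2 \<in> C \<and> h\<^sub>1 \<noteq> h\<^sub>2 \<and> (h\<^sub>1, h\<^sub>2) \<in> R C))"

definition incompatibility ::
    "('v, 'e) chart \<Rightarrow> ('e half_edge set \<Rightarrow> 'e half_edge rel) \<Rightarrow>
     'e oriented_edge list \<Rightarrow> 'e oriented_edge list \<Rightarrow> bool" where
  "incompatibility G R p' q' \<longleftrightarrow>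
     (\<exists>\<alpha>\<^sub>1 \<alpha>\<^sub>2 s \<beta>\<^sub>1 \<beta>\<^sub>2.
        p' = \<alpha>\<^sub>1 # s @ [\<beta>\<^sub>1] \<and> q' = \<alpha>\<^sub>2 # s @ [\<beta>\<^sub>2] \<and> is_string G (\<alpha>\<^sub>1 # s @ [\<beta>\<^sub>1]) \<and>
        frame_less G R (head_half \<alpha>\<^sub>1) (head_half \<alpha>\<^sub>2) \<and>
        frame_less G R (tail_half \<beta>\<^sub>1) (tail_half \<beta>\<^sub>2))"

definition incompatible ::
    "('v, 'e) chart \<Rightarrow> ('e half_edge set \<Rightarrow> 'e half_edge rel) \<Rightarrow> 'e trail \<Rightarrow> 'e trail \<Rightarrow> bool" where
  "incompatible G R T U \<longleftrightarrow>
     (\<exists>p' \<in> substrings G T. \<exists>q' \<in> substrings G U.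
        incompatibility G R p' q' \<or> incompatibility G R q' p')"

text \<open>The trails below need not be distinct: every trail of a bundle is compatible with itself.\<close>

definition is_bundle ::
    "('v, 'e) chart \<Rightarrow> ('e half_edge set \<Rightarrow> 'e half_edge rel) \<Rightarrow> 'e trail set \<Rightarrow> bool" where
  "is_bundle G R K \<longleftrightarrow> K \<subseteq> trails G \<and> (\<forall>T \<in> K. \<forall>U \<in> K. \<not> incompatible G R T U)"

text \<open>
  As for every linear combination, only finitely many coefficients are nonzero; the sum is taken
  over these, since a sum over an infinite index set would be \<open>0\<close> by convention.
\<close>

definition represents ::
    "('v, 'e) chart \<Rightarrow> ('e half_edge set \<Rightarrow> 'e half_edge rel) \<Rightarrow>
     'e trail set \<Rightarrow> ('e trail \<Rightarrow> real) \<Rightarrow> ('e \<Rightarrow> real) \<Rightarrow> bool" where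
  "represents G R K a F \<longleftrightarrow>
     is_bundle G R K \<and> (\<forall>T \<in> K. 0 \<le> a T) \<and> finite {T \<in> K. a T \<noteq> 0} \<and>
     F = (\<lambda>e. \<Sum>T \<in> {T \<in> K. a T \<noteq> 0}. a T * trail_vec T e)"

definition positively_represents ::
    "('v, 'e) chart \<Rightarrow> ('e half_edge set \<Rightarrow> 'e half_edge rel) \<Rightarrow>
     'e trail set \<Rightarrow> ('e trail \<Rightarrow> real) \<Rightarrow> ('e \<Rightarrow> real) \<Rightarrow> bool" where
  "positively_represents G R K a F \<longleftrightarrow> represents G R K a F \<and> (\<forall>T \<in> K. 0 < a T)"

definition bundle_combination ::
    "('v, 'e) chart \<Rightarrow> ('e half_edge set \<Rightarrow> 'e half_edge rel) \<Rightarrow> ('e \<Rightarrow> real) \<Rightarrow> bool" where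
  "bundle_combination G R F \<longleftrightarrow> (\<exists>K a. represents G R K a F)"

end

theory Submission
  imports Defs
begin

text \<open>
  Count with multiplicity \<open>N(s)\<close> how often a string \<open>s\<close> occurs in the trails of a weighted bundle, in
  either orientation.  On single edges \<open>N\<close> is the flow.  At internal vertices \<open>N(s)\<close> is the sum of
  \<open>N(s \<beta>)\<close> over all \<open>\<beta>\<close>, and also of \<open>N(\<alpha> s)\<close> over all \<open>\<alpha>\<close>, and compatibility says that the support of the
  matrix \<open>N(\<alpha> s \<beta>)\<close> is a staircase.  Such a matrix is determined by its marginals, and it is
  integral if they are; hence the flow determines \<open>N\<close>, by induction on the length.  The
  coefficient of a trail is in turn a value of \<open>N\<close>: take for \<open>s\<close> the whole route, or a high power
  of the band.

  Conversely, replace each edge of an integer flow \<open>F\<close> by \<open>F(e)\<close> parallel strands and match the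
  strands of the two classes at each vertex in opposite order.  The strands then close up to
  routes and powers of bands which never cross, and averaging over the orbits of the resulting
  permutation gives the coefficients.  Rational flows follow by scaling, and they are dense by
  simultaneous Diophantine approximation.
\<close>

text \<open>
  The abbreviation \<open>tail_half \<alpha> \<equiv> \<alpha>\<close> matches every half-edge, so that folding it back when a term is
  printed does not terminate.
\<close>

declare [[show_abbrevs = false]]

section \<open>Words\<close>

text \<open>Two points shape uniqueness. Strings are counted in both orientations, because the value
  of a flow on an edge does not see directions; a coefficient is still recovered exactly, and not
  doubled, because no nonempty string equals its inverse and no band is a rotation of its inverse.
  And different bands may share long substrings. A power at least as long as the sum of the two
  periods separates them: two periods on so long a word make the period words commute, and commuting
  primitive words coincide. The staircase is the definition of incompatibility read off a matrix:
  with the middle string fixed, two nonzero entries whose row and column indices both increase are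
  forbidden. The support thus runs in the antitone direction, which is also why strands are matched
  in opposite order. Averaging over orbits yields coefficients that are a priori only rational.
  Integrality is therefore not read off the construction; it holds for every representation, by the
  same entry formula that gives uniqueness.\<close>

lemma other_half_invol [simp]: "other_half (other_half h) = h"
  by (simp add: other_half_def)

lemma other_half_neq [simp]: "other_half h \<noteq> h" "h \<noteq> other_half h"
  by (cases h; simp add: other_half_def)+

lemma fst_other_half [simp]: "fst (other_half h) = fst h"
  by (simp add: other_half_def)

lemma other_half_in_half_edges [simp]: "other_half h \<in> half_edges G \<longleftrightarrow> h \<in> half_edges G"
  by (simp add: half_edges_def other_half_def mem_Times_iff)

lemma inv_string_simps [simp]:
  "inv_string [] = []"
  "length (inv_string s) = length s"
  "inv_string (s @ t) = inv_string t @ inv_string s"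
  "inv_string s = [] \<longleftrightarrow> s = []"
  by (simp_all add: inv_string_def)

lemma inv_string_Cons: "inv_string (\<alpha> # s) = inv_string s @ [other_half \<alpha>]"
  by (simp add: inv_string_def)

lemma inv_string_invol [simp]: "inv_string (inv_string s) = s"
  by (simp add: inv_string_def rev_map o_def)

lemma inv_string_eq_iff: "inv_string s = t \<longleftrightarrow> s = inv_string t"
  by auto

lemma hd_inv_string: "s \<noteq> [] \<Longrightarrow> hd (inv_string s) = other_half (last s)"
  by (simp add: inv_string_def hd_rev last_map)

lemma last_inv_string: "s \<noteq> [] \<Longrightarrow> last (inv_string s) = other_half (hd s)"
  by (simp add: inv_string_def last_rev hd_map)

lemma inv_string_rotate: "\<exists>k. inv_string (rotate n s) = rotate k (inv_string s)"
proof -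
  have "rotate n s = drop (n mod length s) s @ take (n mod length s) s"
    by (rule rotate_drop_take)
  moreover have "inv_string s
      = inv_string (drop (n mod length s) s) @ inv_string (take (n mod length s) s)"
    by (metis append_take_drop_id inv_string_simps(3))
  ultimately show ?thesis
    by (metis inv_string_simps(3) rotate_append)
qed

lemma rotate_back: "\<exists>k. rotate k (rotate n s) = s"
proof -
  have "rotate n s = drop (n mod length s) s @ take (n mod length s) s"
    by (rule rotate_drop_take)
  then show ?thesis
    by (metis append_take_drop_id rotate_append)
qed

lemma string_power_simps [simp]:
  "string_power B 0 = []"
  "string_power B (Suc k) = B @ string_power B k"
  "length (string_power B k) = k * length B"
  by (simp_all add: string_power_def length_concat sum_list_replicate)

lemma concat_replicate_power: "concat (replicate k z) = string_power z k"
  by (simp add: string_power_def)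

lemma string_power_add: "string_power B (k + l) = string_power B k @ string_power B l"
  by (simp add: string_power_def replicate_add)

lemma string_power_mult: "string_power (string_power B k) l = string_power B (k * l)"
  by (induction l) (simp_all add: string_power_add)

lemma string_power_Suc': "string_power B (Suc k) = string_power B k @ B"
  using string_power_add [of B k 1] by simp

lemma inv_string_power: "inv_string (string_power B k) = string_power (inv_string B) k"
proof (induction k)
  case (Suc k)
  have "inv_string (string_power B (Suc k)) = string_power (inv_string B) k @ inv_string B"
    by (simp add: Suc)
  then show ?case
    by (simp only: string_power_Suc')
qed simp

text \<open>Exhibits a power of the rotation \<open>v @ u\<close> inside a power of
  \<open>u @ v\<close>, so that passing to powers makes the starting point of a band
  immaterial.\<close>

lemma rotate_append_swap:
  "string_power (u @ v) (Suc k) = u @ string_power (v @ u) k @ v"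
  by (induction k) simp_all

lemma sublist_power_rotate: "sublist (string_power (rotate n B) k) (string_power B (Suc k))"
proof -
  have "rotate n B = drop (n mod length B) B @ take (n mod length B) B"
    by (rule rotate_drop_take)
  then show ?thesis
    using rotate_append_swap [of "take (n mod length B) B" "drop (n mod length B) B" k]
    by (metis append_take_drop_id sublist_appendI)
qed

lemma string_power_rotate: "string_power (rotate n s) k = rotate n (string_power s k)"
proof (induction n)
  case (Suc n)
  have "string_power (rotate1 t) k = rotate1 (string_power t k)" for t :: "'a list"
  proof (cases k)
    case (Suc l)
    show ?thesis
    proof (cases t)
      case (Cons x xs)
      have *: "string_power (x # xs) (Suc l) = x # string_power (xs @ [x]) l @ xs"
        using rotate_append_swap [of "[x]" xs l] by (simp del: string_power_simps(2))
      then show ?thesis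
        unfolding Cons Suc * rotate1.simps by (simp only: string_power_Suc' append.assoc append_Nil)
    qed (simp add: string_power_def)
  qed simp
  then show ?case
    by (simp add: Suc)
qed simp

lemma nth_string_power: "i < k * length B \<Longrightarrow> string_power B k ! i = B ! (i mod length B)"
proof (induction k arbitrary: i)
  case (Suc k)
  show ?case
  proof (cases "i < length B")
    case False
    then show ?thesis
      using Suc by (simp add: nth_append le_mod_geq)
  qed (simp add: nth_append)
qed simp

section \<open>Strings\<close>

lemma is_string_sublist: "is_string G t \<Longrightarrow> sublist s t \<Longrightarrow> is_string G s"
  by (auto simp: is_string_def sublist_def successively_append_iff)

lemma is_string_power:
  assumes "is_string G (B @ B)"
  shows "is_string G (string_power B k)"
proof (induction k)
  case (Suc k)
  then show ?case
    using assms by (cases k) (auto simp: is_string_def successively_append_iff)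
qed (simp add: is_string_def)

locale framed_chart =
  fixes G :: "('v, 'e) chart" and R :: "'e half_edge set \<Rightarrow> 'e half_edge rel"
  assumes chart: "turbulence_chart G" and framing: "framing G R"
begin

section \<open>Opposite classes at internal vertices\<close>

definition internal :: "'e half_edge \<Rightarrow> bool" where
  "internal h \<longleftrightarrow> internal_vertex G (vertex_of G h)"

text \<open>At an internal vertex this is the other class, so the continuations of an oriented edge
  form a whole class and carry the linear order of the framing.\<close>

definition opposite :: "'e half_edge \<Rightarrow> 'e half_edge set" where
  "opposite h = {g \<in> half_edges_at G (vertex_of G h). (h, g) \<notin> vsim G (vertex_of G h)}"

lemma finite_half_edges [simp]: "finite (half_edges G)"
  using chart by (simp add: turbulence_chart_def half_edges_def)

lemma finite_half_edges_at [simp]: "finite (half_edges_at G v)"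
  by (simp add: half_edges_at_def)

lemma vertex_in_verts: "h \<in> half_edges G \<Longrightarrow> vertex_of G h \<in> verts G"
  using chart by (auto simp: turbulence_chart_def)

lemma internal_iff: "h \<in> half_edges G \<Longrightarrow> internal h \<longleftrightarrow> \<not> fringe_vertex G (vertex_of G h)"
  by (simp add: internal_def internal_vertex_def vertex_in_verts)

lemma equiv_vsim: "internal_vertex G v \<Longrightarrow> equiv (half_edges_at G v) (vsim G v)"
  using chart by (simp add: turbulence_chart_def)

lemma sym_vsim: "internal_vertex G v \<Longrightarrow> (g, h) \<in> vsim G v \<longleftrightarrow> (h, g) \<in> vsim G v"
  using equiv_vsim by (meson equivE symD)

lemma composable_iff:
  "\<beta> \<in> half_edges G \<Longrightarrow> composable G \<alpha> \<beta> \<longleftrightarrow> internal (other_half \<alpha>) \<and> \<beta> \<in> opposite (other_half \<alpha>)"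
  by (auto simp: composable_def internal_def opposite_def half_edges_at_def)

lemma opposite_subset: "opposite h \<subseteq> half_edges G"
  by (auto simp: opposite_def half_edges_at_def)

lemma finite_opposite [simp]: "finite (opposite h)"
  using opposite_subset finite_half_edges finite_subset by blast

lemma vertex_opposite: "g \<in> opposite h \<Longrightarrow> vertex_of G g = vertex_of G h"
  by (auto simp: opposite_def half_edges_at_def)

lemma internal_opposite: "g \<in> opposite h \<Longrightarrow> internal g \<longleftrightarrow> internal h"
  by (simp add: internal_def vertex_opposite)

lemma opposite_sym:
  "h \<in> half_edges G \<Longrightarrow> internal h \<Longrightarrow> g \<in> opposite h \<Longrightarrow> h \<in> opposite g"
  by (auto simp: opposite_def half_edges_at_def internal_def sym_vsim)

lemma not_in_opposite: "h \<in> half_edges G \<Longrightarrow> internal h \<Longrightarrow> h \<notin> opposite h"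
  using equiv_class_eq_iff [OF equiv_vsim, of "vertex_of G h" h h]
  by (auto simp: opposite_def internal_def half_edges_at_def)

lemma class_of:
  assumes "h \<in> half_edges G" "internal h"
  shows "vsim G (vertex_of G h) `` {h} \<in> vclasses G (vertex_of G h)"
    "h \<in> vsim G (vertex_of G h) `` {h}"
  using assms equiv_class_eq_iff [OF equiv_vsim, of "vertex_of G h" h h]
  by (auto simp: vclasses_def internal_def half_edges_at_def intro: quotientI)

lemma opposite_eq:
  assumes "internal_vertex G v" "C \<in> vclasses G v" "D \<in> vclasses G v" "C \<noteq> D" "h \<in> C"
  shows "opposite h = D"
proof -
  note eq = equiv_vsim [OF assms(1)]
  have v: "vertex_of G h = v" and hv: "h \<in> half_edges_at G v"
    using in_quotient_imp_subset [OF eq, of C] assms by (auto simp: vclasses_def half_edges_at_def)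
  have "card (vclasses G v) = 2"
    using chart assms(1) by (simp add: turbulence_chart_def)
  then have CD: "vclasses G v = {C, D}"
    using assms(2-4) by (auto simp: card_2_iff)
  have C: "C = vsim G v `` {h}"
  proof -
    from assms(2) obtain x where x: "C = vsim G v `` {x}"
      unfolding vclasses_def by (rule quotientE)
    with assms(5) have "(x, h) \<in> vsim G v"
      by blast
    then show ?thesis
      unfolding x by (rule equiv_class_eq [OF eq])
  qed
  have "\<Union>(vclasses G v) = half_edges_at G v"
    unfolding vclasses_def using Union_quotient [OF eq] .
  moreover have "C \<inter> D = {}"
    using quotient_disj [OF eq] assms(2-4) unfolding vclasses_def by blast
  ultimately have "D = half_edges_at G v - C"
    unfolding CD by auto
  then show ?thesis
    unfolding C opposite_def v by auto
qed

lemma opposite_in_vclasses: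
  assumes "h \<in> half_edges G" "internal h"
  shows "opposite h \<in> vclasses G (vertex_of G h)"
proof -
  let ?v = "vertex_of G h"
  have "internal_vertex G ?v" "card (vclasses G ?v) = 2"
    using chart assms(2) by (simp_all add: turbulence_chart_def internal_def)
  moreover from this obtain D where "D \<in> vclasses G ?v" "D \<noteq> vsim G ?v `` {h}"
    by (metis card_2_iff insert_iff)
  ultimately show ?thesis
    using opposite_eq class_of [OF assms] by metis
qed

lemma composable_inv:
  assumes "\<alpha> \<in> half_edges G" "\<beta> \<in> half_edges G" "composable G \<alpha> \<beta>"
  shows "composable G (other_half \<beta>) (other_half \<alpha>)"
  using assms opposite_sym [of "other_half \<alpha>" \<beta>] internal_opposite
  by (auto simp: composable_iff)

lemma is_string_inv:
  assumes "is_string G s"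
  shows "is_string G (inv_string s)"
proof -
  have "successively (\<lambda>\<alpha> \<beta>. composable G (other_half \<beta>) (other_half \<alpha>)) s"
    using assms unfolding is_string_def
    by (auto intro: successively_mono composable_inv)
  then show ?thesis
    using assms unfolding is_string_def inv_string_def by (auto simp: successively_map)
qed

text \<open>
  The middle of a palindromic string would be an edge that equals its own inverse or a pair
  \<open>\<alpha> \<alpha>\<inverse>\<close>, which is never composable.
\<close>

lemma string_not_palindrome:
  assumes "is_string G s" "s \<noteq> []"
  shows "inv_string s \<noteq> s"
proof
  assume s: "inv_string s = s"
  define n where "n = length s"
  have nth: "s ! (n - Suc i) = other_half (s ! i)" if "i < n" for i
  proof -
    have "inv_string s ! i = other_half (s ! (n - Suc i))"
      using that by (simp add: inv_string_def rev_nth n_def)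
    then show ?thesis
      by (simp add: s)
  qed
  show False
  proof (cases "even n")
    case False
    then obtain k where "n = 2 * k + 1"
      by (elim oddE)
    then show False
      using nth [of k] by simp
  next
    case True
    then obtain k where "n = 2 * k"
      by (elim evenE)
    with assms(2) have n: "n = 2 * Suc (k - 1)"
      by (cases k) (auto simp: n_def)
    define i where "i = k - 1"
    have i: "Suc i < n" "s ! Suc i = other_half (s ! i)"
      using n nth [of i] by (auto simp: i_def)
    then have "composable G (s ! i) (other_half (s ! i))" and "s ! i \<in> half_edges G"
      using assms(1) successively_nth [of "composable G" s i]
      by (auto simp: is_string_def n_def dest: nth_mem)
    then show False
      using not_in_opposite [of "other_half (s ! i)"] by (auto simp: composable_iff)
  qed
qed

lemma is_route_inv:
  assumes "is_route G p"
  shows "is_route G (inv_string p)"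
  using assms is_string_inv [of p] by (auto simp: is_route_def hd_inv_string last_inv_string)

text \<open>The closing step of a band passes through an internal vertex, while a route starts at a
  fringe vertex.\<close>

lemma is_band_not_route: "is_band G p \<Longrightarrow> \<not> is_route G p"
  by (auto simp: is_band_def is_route_def is_string_def successively_append_iff composable_def
      internal_vertex_def)

lemma is_band_inv:
  assumes "is_band G B"
  shows "is_band G (inv_string B)"
proof -
  have "\<not> (k \<ge> 2 \<and> is_string G s \<and> inv_string B = string_power s k)" for s k
    using assms is_string_inv unfolding is_band_def inv_string_eq_iff inv_string_power by blast
  moreover have "is_string G (inv_string B @ inv_string B)"
    using assms is_string_inv unfolding is_band_def by (metis inv_string_simps(3))
  ultimately show ?thesis
    using assms by (simp add: is_band_def)
qed

lemma is_band_rotate: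
  assumes "is_band G B"
  shows "is_band G (rotate n B)"
proof -
  have BB: "is_string G (B @ B)"
    using assms by (simp add: is_band_def)
  have "is_string G (string_power (rotate n B) 2)"
    using is_string_sublist [OF is_string_power [OF BB] sublist_power_rotate] .
  then have *: "is_string G (rotate n B @ rotate n B)"
    by (simp add: numeral_2_eq_2)
  have "False" if k: "k \<ge> 2" and "is_string G s" and s: "rotate n B = string_power s k" for s k
  proof -
    obtain m where "rotate m (rotate n B) = B"
      using rotate_back by blast
    then have B: "B = string_power (rotate m s) k"
      using s by (simp add: string_power_rotate)
    \<comment> \<open>Primitivity speaks only of roots that are strings, so the rotated root has to
      be recognized as a factor of \<open>B @ B\<close>.\<close>
    moreover have "is_string G (rotate m s)"
    proof (rule is_string_sublist)
      show "is_string G (B @ B)" by fact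
      show "sublist (rotate m s) (B @ B)"
        using k unfolding B by (cases k) auto
    qed
    ultimately show False
      using assms k by (auto simp: is_band_def)
  qed
  then show ?thesis
    using assms * by (auto simp: is_band_def)
qed

end

section \<open>Staircase matrices\<close>

text \<open>The staircase condition empties one of two neighbouring blocks: either the rows in
  \<open>X\<close> have no mass outside \<open>Y\<close>, or the columns in \<open>Y\<close> have
  none outside \<open>X\<close>. The mass of the block is then a full row total or a full column
  total, and it never exceeds either.\<close>

lemma staircase_block:
  fixes M :: "'a \<Rightarrow> 'b \<Rightarrow> real"
  assumes fin: "finite C" "finite D" and sub: "X \<subseteq> C" "Y \<subseteq> D"
    and nonneg: "\<And>h g. h \<in> C \<Longrightarrow> g \<in> D \<Longrightarrow> 0 \<le> M h g"
    and stair: "\<And>h h' g g'. h \<in> X \<Longrightarrow> h' \<in> C - X \<Longrightarrow> g \<in> D - Y \<Longrightarrow> g' \<in> Y \<Longrightarrow>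
      M h g = 0 \<or> M h' g' = 0"
  shows "(\<Sum>h\<in>X. \<Sum>g\<in>Y. M h g) = min (\<Sum>h\<in>X. \<Sum>g\<in>D. M h g) (\<Sum>g\<in>Y. \<Sum>h\<in>C. M h g)"
proof -
  have row: "(\<Sum>h\<in>X. \<Sum>g\<in>D. M h g) = (\<Sum>h\<in>X. \<Sum>g\<in>Y. M h g) + (\<Sum>h\<in>X. \<Sum>g\<in>D-Y. M h g)"
    using fin sub by (simp add: sum.subset_diff [OF sub(2) fin(2)] sum.distrib)
  have "(\<Sum>g\<in>Y. \<Sum>h\<in>C. M h g) = (\<Sum>g\<in>Y. \<Sum>h\<in>X. M h g) + (\<Sum>g\<in>Y. \<Sum>h\<in>C-X. M h g)"
    using fin sub by (simp add: sum.subset_diff [OF sub(1) fin(1)] sum.distrib)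
  also have "(\<Sum>g\<in>Y. \<Sum>h\<in>X. M h g) = (\<Sum>h\<in>X. \<Sum>g\<in>Y. M h g)"
    by (rule sum.swap)
  finally have col: "(\<Sum>g\<in>Y. \<Sum>h\<in>C. M h g)
    = (\<Sum>h\<in>X. \<Sum>g\<in>Y. M h g) + (\<Sum>g\<in>Y. \<Sum>h\<in>C-X. M h g)" .
  have "(\<Sum>h\<in>X. \<Sum>g\<in>D-Y. M h g) \<ge> 0" "(\<Sum>g\<in>Y. \<Sum>h\<in>C-X. M h g) \<ge> 0"
    using sub by (auto intro!: sum_nonneg nonneg)
  moreover have "(\<Sum>h\<in>X. \<Sum>g\<in>D-Y. M h g) = 0 \<or> (\<Sum>g\<in>Y. \<Sum>h\<in>C-X. M h g) = 0"
  proof (cases "\<forall>h\<in>X. \<forall>g\<in>D-Y. M h g = 0")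
    case False
    then have "\<forall>g\<in>Y. \<forall>h\<in>C-X. M h g = 0"
      using stair by blast
    then show ?thesis
      by simp
  qed simp
  ultimately show ?thesis
    unfolding row col by linarith
qed

text \<open>
  A nonnegative matrix whose support is a staircase is determined by its marginals, as in the
  northwest corner rule.
\<close>

lemma staircase_entry:
  fixes M :: "'a \<Rightarrow> 'b \<Rightarrow> real"
  assumes fin: "finite C" "finite D" and mem: "h \<in> C" "g \<in> D"
    and nonneg: "\<And>h g. h \<in> C \<Longrightarrow> g \<in> D \<Longrightarrow> 0 \<le> M h g"
    and less: "irreflp_on C lt" "totalp_on C lt" "transp_on C lt"
    and less': "irreflp_on D lt'" "totalp_on D lt'" "transp_on D lt'"
    and stair: "\<And>h h' g g'. h \<in> C \<Longrightarrow> h' \<in> C \<Longrightarrow> g \<in> D \<Longrightarrow> g' \<in> D \<Longrightarrow> lt h h' \<Longrightarrow> lt' g g' \<Longrightarrow>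
      M h g = 0 \<or> M h' g' = 0"
    and row: "\<And>h. h \<in> C \<Longrightarrow> (\<Sum>g\<in>D. M h g) = r h"
    and col: "\<And>g. g \<in> D \<Longrightarrow> (\<Sum>h\<in>C. M h g) = c g"
    and L: "L = {x \<in> C. lt x h}" and U: "U = {y \<in> D. lt' g y}"
  shows "M h g = min (sum r (insert h L)) (sum c (insert g U)) - min (sum r L) (sum c (insert g U))
     - min (sum r (insert h L)) (sum c U) + min (sum r L) (sum c U)"
proof -
  \<comment> \<open>\<open>X\<close> is an initial segment of the rows and \<open>Y\<close> a final
    segment of the columns, which is the position in which the staircase condition applies to the
    two neighbouring blocks.\<close>
  have block: "(\<Sum>h\<in>X. \<Sum>g\<in>Y. M h g) = min (sum r X) (sum c Y)"
    if X: "X = L \<or> X = insert h L" and Y: "Y = U \<or> Y = insert g U" for X Y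
  proof -
    have sub: "X \<subseteq> C" "Y \<subseteq> D"
      using X Y mem by (auto simp: L U)
    have "lt x x'" if "x \<in> X" "x' \<in> C - X" for x x'
    proof (cases "x = h")
      case True
      then show ?thesis
        using that X mem less(2) unfolding L by (auto dest: totalp_onD)
    next
      case False
      then have x: "x \<in> C" "lt x h"
        using that X by (auto simp: L)
      show ?thesis
      proof (cases "x' = h")
        case False
        then have "lt h x'"
          using that X mem less(2) unfolding L by (auto dest: totalp_onD)
        then show ?thesis
          using transp_onD [OF less(3) x(1) mem(1) _ x(2)] that by blast
      qed (use x in simp)
    qed
    moreover have "lt' y' y" if "y \<in> Y" "y' \<in> D - Y" for y y'
    proof (cases "y = g")
      case True
      then show ?thesis
        using that Y mem less'(2) unfolding U by (auto dest: totalp_onD)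
    next
      case False
      then have y: "y \<in> D" "lt' g y"
        using that Y by (auto simp: U)
      show ?thesis
      proof (cases "y' = g")
        case False
        then have "lt' y' g"
          using that Y mem less'(2) unfolding U by (auto dest: totalp_onD)
        then show ?thesis
          using transp_onD [OF less'(3) _ mem(2) y(1) _ y(2)] that by blast
      qed (use y in simp)
    qed
    ultimately have "(\<Sum>h\<in>X. \<Sum>g\<in>Y. M h g)
        = min (\<Sum>h\<in>X. \<Sum>g\<in>D. M h g) (\<Sum>g\<in>Y. \<Sum>h\<in>C. M h g)"
      using sub by (intro staircase_block fin sub nonneg stair) auto
    also have "\<dots> = min (sum r X) (sum c Y)"
      using sub by (intro arg_cong2 [of _ _ _ _ min] sum.cong) (auto simp: row col)
    finally show ?thesis .
  qed
  have "h \<notin> L" "g \<notin> U" "finite L" "finite U"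
    using fin less(1) less'(1) mem by (auto simp: L U dest: irreflp_onD)
  \<comment> \<open>A single entry is an alternating sum of four corner blocks. The explicit formula
    serves integrality as well as uniqueness.\<close>
  then have "M h g = (\<Sum>h\<in>insert h L. \<Sum>g\<in>insert g U. M h g) - (\<Sum>h\<in>L. \<Sum>g\<in>insert g U. M h g)
     - (\<Sum>h\<in>insert h L. \<Sum>g\<in>U. M h g) + (\<Sum>h\<in>L. \<Sum>g\<in>U. M h g)"
    by simp
  then show ?thesis
    by (simp only: block simp_thms)
qed

lemma Ints_min: "x \<in> \<int> \<Longrightarrow> y \<in> \<int> \<Longrightarrow> min x y \<in> (\<int> :: real set)"
  by (simp add: min_def)

section \<open>Occurrences of strings in trails\<close>

lemma count_list_conv_sum: "real (count_list w \<alpha>) = (\<Sum>i<length w. of_bool (w ! i = \<alpha>))"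
proof (induction w)
  case (Cons x w)
  then show ?case
    unfolding length_Cons sum.lessThan_Suc_shift by simp
qed simp

lemma count_list_inv_string: "count_list (inv_string w) \<alpha> = count_list w (other_half \<alpha>)"
  by (induction w) (auto simp: inv_string_Cons)

lemma count_list_edge:
  "count_list (map fst w) (fst \<alpha>) = count_list w \<alpha> + count_list w (other_half \<alpha>)"
proof (induction w)
  case (Cons x w)
  have "fst x = fst \<alpha> \<longleftrightarrow> x = \<alpha> \<or> x = other_half \<alpha>"
    by (cases x; cases \<alpha>) (auto simp: other_half_def)
  then show ?case
    using Cons other_half_neq [of \<alpha>] by (cases "x = \<alpha>") (simp_all del: other_half_neq)
qed simp

context framed_chart
begin

lemma opposite_cong:
  assumes "k \<in> half_edges G" "internal k" "h \<in> opposite k" "h' \<in> opposite k"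
  shows "opposite h = opposite h'"
proof -
  have "vsim G (vertex_of G k) `` {k} \<noteq> opposite k"
    using class_of(2) [OF assms(1,2)] not_in_opposite [OF assms(1,2)] by metis
  then have "opposite x = vsim G (vertex_of G k) `` {k}" if "x \<in> opposite k" for x
    using opposite_eq [OF _ opposite_in_vclasses [OF assms(1,2)] class_of(1) [OF assms(1,2)] _ that]
      assms(2) unfolding internal_def by metis
  then show ?thesis
    using assms by simp
qed

lemma frame_less_on_opposite:
  assumes "k \<in> half_edges G" "internal k"
  shows "irreflp_on (opposite k) (frame_less G R)" "totalp_on (opposite k) (frame_less G R)"
proof -
  let ?C = "opposite k"
  have C: "internal_vertex G (vertex_of G k)" "?C \<in> vclasses G (vertex_of G k)"
    using assms opposite_in_vclasses by (simp_all add: internal_def)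
  then have "linear_order_on ?C (R ?C)"
    using framing by (simp add: framing_def)
  then show "totalp_on ?C (frame_less G R)"
    using C unfolding totalp_on_def frame_less_def linear_order_on_def total_on_def by blast
  show "irreflp_on ?C (frame_less G R)"
    by (auto simp: irreflp_on_def frame_less_def)
qed

lemma vclasses_unique:
  assumes "internal_vertex G v" "C \<in> vclasses G v" "internal_vertex G v'" "C' \<in> vclasses G v'"
    and "h \<in> C" "h \<in> C'"
  shows "C = C'"
proof -
  have "h \<in> half_edges_at G v" "h \<in> half_edges_at G v'"
    using assms equiv_vsim in_quotient_imp_subset unfolding vclasses_def by blast+
  then have "v = v'"
    by (simp add: half_edges_at_def)
  then show ?thesis
    using assms equiv_vsim quotient_disj unfolding vclasses_def by blast
qed

text \<open>\<open>frame_less\<close> is assembled from orders on many classes; the shared middle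
  element forces both comparisons into the same class.\<close>

lemma frame_less_trans:
  assumes "frame_less G R x y" "frame_less G R y z"
  shows "frame_less G R x z"
proof -
  obtain v C v' C' where *: "internal_vertex G v" "C \<in> vclasses G v" "x \<in> C" "y \<in> C" "(x, y) \<in> R C"
      "x \<noteq> y" "y \<noteq> z" "internal_vertex G v'" "C' \<in> vclasses G v'" "y \<in> C'" "z \<in> C'" "(y, z) \<in> R C'"
    using assms unfolding frame_less_def by blast
  then have C: "C' = C"
    using vclasses_unique by metis
  have "linear_order_on C (R C)"
    using framing * by (simp add: framing_def)
  then have "(x, z) \<in> R C" "x \<noteq> z"
    using * unfolding C linear_order_on_def partial_order_on_def preorder_on_def
    by (metis transD, metis antisymD)
  then show ?thesis
    using * unfolding C frame_less_def by blast
qed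

lemma frame_less_irrefl: "\<not> frame_less G R x x"
  by (simp add: frame_less_def)

lemma transp_on_frame_less: "transp_on C (frame_less G R)"
  using frame_less_trans by (blast intro: transp_onI)

section \<open>Occurrences in routes and in cyclically read bands\<close>

definition trail_word :: "'e oriented_edge list \<Rightarrow> bool" where
  "trail_word w \<longleftrightarrow> is_route G w \<or> is_band G w"

text \<open>A band is read as a periodic infinite word, a route as a word that stops. Occurrences
  winding several times around a band are thus treated like those in a route.\<close>

definition letter :: "'e oriented_edge list \<Rightarrow> nat \<Rightarrow> 'e oriented_edge option" where
  "letter w i =
     (if is_band G w then Some (w ! (i mod length w)) else if i < length w then Some (w ! i) else None)"

definition occurs_at :: "'e oriented_edge list \<Rightarrow> nat \<Rightarrow> 'e oriented_edge list \<Rightarrow> bool" where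
  "occurs_at w i t \<longleftrightarrow> (\<forall>j<length t. letter w (i + j) = Some (t ! j))"

text \<open>Only the starting position is confined to one period; in a band the occurrence itself
  may run beyond \<open>length w\<close>.\<close>

definition occ :: "'e oriented_edge list \<Rightarrow> 'e oriented_edge list \<Rightarrow> real" where
  "occ w t = (\<Sum>i<length w. of_bool (occurs_at w i t))"

lemma trail_word_nonempty: "trail_word w \<Longrightarrow> w \<noteq> []"
  by (auto simp: trail_word_def is_route_def is_band_def)

lemma trail_word_string: "trail_word w \<Longrightarrow> is_string G w"
  by (auto simp: trail_word_def is_route_def is_band_def intro: is_string_sublist)

lemma trail_word_inv: "trail_word w \<Longrightarrow> trail_word (inv_string w)"
  by (auto simp: trail_word_def is_route_inv is_band_inv)

lemma route_ends:
  assumes "is_route G w"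
  shows "\<not> internal (hd w)" "\<not> internal (other_half (last w))"
  using assms by (simp_all add: is_route_def internal_def internal_vertex_def)

lemma letter_in: "trail_word w \<Longrightarrow> letter w i = Some \<alpha> \<Longrightarrow> \<alpha> \<in> half_edges G"
  using trail_word_string [of w] trail_word_nonempty [of w]
  by (auto simp: letter_def is_string_def split: if_splits)

lemma letter_composable:
  assumes "trail_word w" "letter w i = Some \<alpha>" "letter w (Suc i) = Some \<beta>"
  shows "composable G \<alpha> \<beta>"
proof (cases "is_band G w")
  case False
  then show ?thesis
    using assms trail_word_string [of w] successively_nth [of "composable G" w i]
    by (auto simp: letter_def is_string_def split: if_splits)
next
  case True
  define n where "n = length w"
  have n: "n > 0"
    using assms(1) trail_word_nonempty by (auto simp: n_def)
  have "i mod n < n"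
    using n by simp
  then have "Suc (i mod n) < length (w @ w)"
    using n unfolding n_def length_append by linarith
  then have "composable G ((w @ w) ! (i mod n)) ((w @ w) ! Suc (i mod n))"
    using True unfolding is_band_def is_string_def by (blast intro: successively_nth)
  moreover have "(w @ w) ! (i mod n) = \<alpha>"
    using True assms n by (simp add: letter_def n_def nth_append)
  moreover have "(w @ w) ! Suc (i mod n) = \<beta>"
  proof (cases "Suc (i mod n) < n")
    case True
    then have "Suc i mod n = Suc (i mod n)"
      by (metis mod_Suc nat_neq_iff)
    with True show ?thesis
      using assms \<open>is_band G w\<close> by (simp add: letter_def n_def nth_append)
  next
    case False
    then have *: "Suc (i mod n) = n"
      using n by (meson Suc_leI le_antisym mod_less_divisor not_less)
    then have "Suc i mod n = 0"
      by (metis mod_Suc)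
    with * show ?thesis
      using assms \<open>is_band G w\<close> by (simp add: letter_def n_def nth_append)
  qed
  ultimately show ?thesis
    by simp
qed

lemma letter_in_opposite:
  assumes "trail_word w" "letter w i = Some \<alpha>" "letter w (Suc i) = Some \<beta>"
  shows "\<beta> \<in> opposite (other_half \<alpha>)" "other_half \<alpha> \<in> opposite \<beta>"
    "internal (other_half \<alpha>)" "internal \<beta>"
proof -
  have "composable G \<alpha> \<beta>" "\<alpha> \<in> half_edges G" "\<beta> \<in> half_edges G"
    using letter_composable letter_in assms by blast+
  then show 1: "\<beta> \<in> opposite (other_half \<alpha>)" "internal (other_half \<alpha>)"
    by (simp_all add: composable_iff)
  then show "other_half \<alpha> \<in> opposite \<beta>" "internal \<beta>"
    using \<open>\<alpha> \<in> half_edges G\<close> by (simp_all add: opposite_sym internal_opposite)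
qed

lemma letter_Suc_exists:
  assumes "trail_word w" "letter w i = Some \<alpha>" "internal (other_half \<alpha>)"
  obtains \<beta> where "letter w (Suc i) = Some \<beta>"
proof (cases "is_band G w")
  case False
  then have w: "is_route G w" and i: "i < length w" "w ! i = \<alpha>"
    using assms by (auto simp: trail_word_def letter_def split: if_splits)
  have "\<not> internal (other_half (last w))"
    using w by (rule route_ends)
  moreover have "last w = \<alpha>" if "i = length w - 1"
    using that i by (subst last_conv_nth) auto
  ultimately have "i \<noteq> length w - 1"
    using assms(3) by blast
  then have "Suc i < length w"
    using i by linarith
  then show ?thesis
    using that [of "w ! Suc i"] False by (simp add: letter_def)
qed (use that in \<open>simp add: letter_def\<close>)

lemma letter_pred_exists:
  assumes "letter w (Suc i) = Some \<beta>"
  obtains \<alpha> where "letter w i = Some \<alpha>"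
  using assms by (simp add: letter_def split: if_splits)

lemma occurs_at_Nil [simp]: "occurs_at w i []"
  by (simp add: occurs_at_def)

lemma occurs_at_Cons [simp]:
  "occurs_at w i (\<alpha> # t) \<longleftrightarrow> letter w i = Some \<alpha> \<and> occurs_at w (Suc i) t"
  by (auto simp: occurs_at_def less_Suc_eq_0_disj)

lemma occurs_at_snoc:
  "occurs_at w i (t @ [\<beta>]) \<longleftrightarrow> occurs_at w i t \<and> letter w (i + length t) = Some \<beta>"
  by (induction t arbitrary: i) auto

text \<open>In a band by periodicity; in a route both sides fail, as it starts at a fringe half-edge
  and has no letter at position \<open>length w\<close>. This permits shifting the range of starting
  positions by one.\<close>

lemma occurs_at_wrap:
  assumes "trail_word w" "t \<noteq> []" "internal (hd t)"
  shows "occurs_at w 0 t \<longleftrightarrow> occurs_at w (length w) t"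
proof (cases "is_band G w")
  case False
  then have w: "is_route G w"
    using assms by (simp add: trail_word_def)
  then have "\<not> internal (hd w)" "w \<noteq> []"
    using route_ends by (simp_all add: is_route_def)
  then have "letter w 0 \<noteq> Some (hd t)" "letter w (length w) \<noteq> Some (hd t)"
    using assms(3) False by (auto simp: letter_def hd_conv_nth)
  then show ?thesis
    using assms(2) by (cases t) simp_all
qed (simp add: occurs_at_def letter_def)

lemma of_bool_as_sum:
  assumes "finite A" "\<And>x. P x \<longleftrightarrow> (Q \<and> x = y)" "Q \<Longrightarrow> y \<in> A"
  shows "of_bool Q = (\<Sum>x\<in>A. of_bool (P x) :: real)"
proof (cases Q)
  case True
  then show ?thesis
    using assms by (simp add: of_bool_def)
qed (use assms in simp)

text \<open>Since the string ends at an internal vertex, every occurrence has exactly one next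
  letter, and it lies in the class opposite to the last head.\<close>

lemma occ_snoc:
  assumes "trail_word w" "t \<noteq> []" "internal (other_half (last t))"
  shows "occ w t = (\<Sum>\<beta>\<in>opposite (other_half (last t)). occ w (t @ [\<beta>]))"
proof -
  have *: "of_bool (occurs_at w i t)
      = (\<Sum>\<beta>\<in>opposite (other_half (last t)). of_bool (occurs_at w i (t @ [\<beta>])) :: real)" for i
  proof -
    let ?\<beta> = "the (letter w (i + length t))"
    have *: "letter w (i + length t) = Some ?\<beta> \<and> ?\<beta> \<in> opposite (other_half (last t))" if "occurs_at w i t"
    proof -
      have l: "letter w (i + (length t - 1)) = Some (last t)"
        using that assms(2) by (simp add: occurs_at_def last_conv_nth)
      have S: "Suc (i + (length t - 1)) = i + length t"
        using assms(2) by (cases t) simp_all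
      obtain \<beta> where "letter w (i + length t) = Some \<beta>"
        using letter_Suc_exists [OF assms(1) l assms(3)] unfolding S by blast
      then show ?thesis
        using letter_in_opposite(1) [OF assms(1) l] unfolding S by simp
    qed
    have "occurs_at w i (t @ [\<beta>]) \<longleftrightarrow> occurs_at w i t \<and> \<beta> = ?\<beta>" for \<beta>
      using * by (auto simp: occurs_at_snoc)
    then show ?thesis
      using * by (intro of_bool_as_sum) auto
  qed
  show ?thesis
    unfolding occ_def * by (rule sum.swap)
qed

lemma occ_Cons:
  assumes "trail_word w" "t \<noteq> []" "internal (hd t)"
  shows "occ w t = (\<Sum>h\<in>opposite (hd t). occ w (other_half h # t))"
proof -
  \<comment> \<open>Starting positions are shifted by one so that each has a predecessor, at which
    the prolonged string starts.\<close>
  have "occ w t = (\<Sum>i<length w. of_bool (occurs_at w (Suc i) t))"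
  proof -
    have "occ w t + of_bool (occurs_at w (length w) t) = (\<Sum>i<Suc (length w). of_bool (occurs_at w i t))"
      by (simp add: occ_def)
    also have "\<dots> = of_bool (occurs_at w 0 t) + (\<Sum>i<length w. of_bool (occurs_at w (Suc i) t))"
      by (rule sum.lessThan_Suc_shift)
    finally show ?thesis
      using occurs_at_wrap [OF assms] by simp
  qed
  moreover have *: "of_bool (occurs_at w (Suc i) t)
      = (\<Sum>h\<in>opposite (hd t). of_bool (occurs_at w i (other_half h # t)) :: real)" for i
  proof -
    let ?h = "other_half (the (letter w i))"
    have *: "letter w i = Some (other_half ?h) \<and> ?h \<in> opposite (hd t)" if "occurs_at w (Suc i) t"
    proof -
      have l: "letter w (Suc i) = Some (hd t)"
        using that assms(2) by (cases t) simp_all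
      with letter_pred_exists obtain \<alpha> where "letter w i = Some \<alpha>"
        by blast
      then show ?thesis
        using letter_in_opposite(2) [OF assms(1) _ l] by simp
    qed
    have "occurs_at w i (other_half h # t) \<longleftrightarrow> occurs_at w (Suc i) t \<and> h = ?h" for h
      using * by auto
    then show ?thesis
      using * by (intro of_bool_as_sum) auto
  qed
  ultimately show ?thesis
    unfolding occ_def by (simp only: *) (rule sum.swap)
qed

lemma occ_nonneg: "0 \<le> occ w t"
  by (simp add: occ_def sum_nonneg)

lemma occ_single: "occ w [\<alpha>] = count_list w \<alpha>"
  unfolding occ_def count_list_conv_sum by (intro sum.cong) (auto simp: letter_def)

section \<open>Representatives of trails\<close>

definition rotations :: "'e oriented_edge list \<Rightarrow> 'e trail" where
  "rotations w = {rotate n w | n. True} \<union> {rotate n (inv_string w) | n. True}"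

lemma rotations_rotate: "{rotate n (rotate m w) | n. True} = {rotate n w | n. True}"
proof -
  have "\<exists>k. rotate n w = rotate k (rotate m w)" for n
    using rotate_back [of m w] by (metis rotate_rotate)
  then show ?thesis
    by (auto simp: rotate_rotate)
qed

lemma rotations_eq:
  assumes "p \<in> rotations w"
  shows "rotations w = rotations p"
proof -
  have rot: "rotations (rotate n u) = rotations u" for n u
  proof -
    obtain k where "inv_string (rotate n u) = rotate k (inv_string u)"
      using inv_string_rotate by blast
    then show ?thesis
      by (simp only: rotations_def rotations_rotate)
  qed
  have inv: "rotations (inv_string w) = rotations w"
    by (simp add: rotations_def Un_commute)
  from assms obtain n where "p = rotate n w \<or> p = rotate n (inv_string w)"
    unfolding rotations_def by blast
  then show ?thesis
    by (elim disjE) (simp_all only: rot inv)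
qed

lemma trail_member:
  assumes "T \<in> trails G" "p \<in> T"
  shows "is_route G p \<and> T = {p, inv_string p} \<or> is_band G p \<and> T = rotations p"
proof (cases "T \<in> routes G")
  case True
  then show ?thesis
    using assms(2) is_route_inv unfolding routes_def by auto
next
  case False
  then obtain B where B: "is_band G B" "T = rotations B"
    using assms(1) by (auto simp: trails_def bands_def rotations_def)
  then have "p \<in> rotations B"
    using assms(2) by simp
  then obtain n where "p = rotate n B \<or> p = rotate n (inv_string B)"
    unfolding rotations_def by blast
  then have "is_band G p"
    using is_band_rotate is_band_inv B(1) by blast
  then show ?thesis
    using rotations_eq [OF \<open>p \<in> rotations B\<close>] B(2) by simp
qed

lemma trail_eq:
  assumes "T \<in> trails G" "U \<in> trails G" "p \<in> T" "p \<in> U"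
  shows "T = U"
  using trail_member [OF assms(1,3)] trail_member [OF assms(2,4)] is_band_not_route [of p] by auto

lemma rotations_self: "p \<in> rotations p"
  unfolding rotations_def by (metis (mono_tags, lifting) UnI1 mem_Collect_eq rotate0 id_apply)

definition rep :: "'e trail \<Rightarrow> 'e oriented_edge list" where
  "rep T = (SOME p. p \<in> T)"

lemma rep_in:
  assumes "T \<in> trails G"
  shows "rep T \<in> T"
proof -
  have "\<exists>p. p \<in> T"
    using assms rotations_self unfolding trails_def routes_def bands_def rotations_def by blast
  then show ?thesis
    unfolding rep_def by (rule someI_ex)
qed

lemma rotate_rep_in:
  assumes "T \<in> trails G" "is_band G (rep T)"
  shows "rotate n (rep T) \<in> T" "rotate n (inv_string (rep T)) \<in> T"
  using trail_member [OF assms(1) rep_in [OF assms(1)]] is_band_not_route [OF assms(2)] assms(2)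
  unfolding rotations_def by auto

lemma inv_rep_in:
  assumes "T \<in> trails G"
  shows "inv_string (rep T) \<in> T"
  using trail_member [OF assms rep_in [OF assms]] rotate_rep_in(2) [OF assms, of 0] by auto

lemma trail_word_rep:
  assumes "T \<in> trails G"
  shows "trail_word (rep T)"
  using trail_member [OF assms rep_in [OF assms]] by (auto simp: trail_word_def)

text \<open>Both orientations are counted because the value of a flow on an edge is blind to
  direction and the words of a trail are closed under inversion.\<close>

definition tocc :: "'e trail \<Rightarrow> 'e oriented_edge list \<Rightarrow> real" where
  "tocc T t = occ (rep T) t + occ (inv_string (rep T)) t"

lemma tocc_single:
  assumes "T \<in> trails G"
  shows "tocc T [\<alpha>] = trail_vec T (fst \<alpha>)"
  by (simp add: tocc_def occ_single trail_vec_def rep_def count_list_edge count_list_inv_string)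

lemma occ_substring:
  assumes "trail_word w" "occ w t \<noteq> 0"
  shows "is_route G w \<and> sublist t w \<or> is_band G w \<and> (\<exists>k. sublist t (string_power w k))"
proof -
  obtain i where i: "i < length w" "occurs_at w i t"
    using assms(2) unfolding occ_def by (auto elim!: sum.not_neutral_contains_not_neutral)
  have sub: "sublist t u" if "i + length t \<le> length u" "\<And>j. j < length t \<Longrightarrow> u ! (i + j) = t ! j" for u
  proof -
    have "t = take (length t) (drop i u)"
      using that by (intro nth_equalityI) auto
    then have "u = take i u @ t @ drop (length t) (drop i u)"
      by (metis append_take_drop_id)
    then show ?thesis
      by (metis sublist_appendI)
  qed
  show ?thesis
  proof (cases "is_band G w")
    case True
    \<comment> \<open>\<open>w\<close> is nonempty, so this exponent gives a power long enough to
      contain the occurrence starting at \<open>i\<close>.\<close>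
    let ?k = "i + length t"
    have le: "?k \<le> ?k * length w"
      using i(1) by simp
    have "sublist t (string_power w ?k)"
    proof (rule sub)
      show "?k \<le> length (string_power w ?k)"
        using le by simp
      show "string_power w ?k ! (i + j) = t ! j" if "j < length t" for j
      proof -
        have "i + j < ?k * length w"
          using that le by linarith
        then show ?thesis
          using i(2) that True by (simp add: nth_string_power occurs_at_def letter_def)
      qed
    qed
    then show ?thesis
      using True by blast
  next
    case False
    then have j: "i + j < length w \<and> w ! (i + j) = t ! j" if "j < length t" for j
      using i that by (auto simp: occurs_at_def letter_def split: if_splits)
    have "i + length t \<le> length w"
      using j [of "length t - 1"] i by (cases t) auto
    then show ?thesis
      using False assms(1) j sub by (auto simp: trail_word_def)
  qed
qed

lemma tocc_substring:
  assumes "T \<in> trails G" "tocc T t \<noteq> 0"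
  shows "t \<in> substrings G T"
proof -
  have "\<exists>w\<in>T. trail_word w \<and> occ w t \<noteq> 0"
    using assms(2) rep_in [OF assms(1)] inv_rep_in [OF assms(1)] trail_word_rep [OF assms(1)]
      trail_word_inv [OF trail_word_rep [OF assms(1)]]
    unfolding tocc_def by (metis add_0)
  then show ?thesis
    using occ_substring unfolding substrings_def by blast
qed

lemma is_string_substring: "t \<in> substrings G T \<Longrightarrow> is_string G t"
  unfolding substrings_def is_route_def is_band_def
  using is_string_sublist is_string_power by blast

section \<open>Weights of strings\<close>

definition weight :: "'e trail set \<Rightarrow> ('e trail \<Rightarrow> real) \<Rightarrow> 'e oriented_edge list \<Rightarrow> real" where
  "weight K a t = (\<Sum>T\<in>K. a T * tocc T t)"

text \<open>Finiteness is demanded because \<open>weight\<close> sums over all of \<open>K\<close>;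
  a representation enters through the support of its coefficients.\<close>

definition weighted_bundle :: "'e trail set \<Rightarrow> ('e trail \<Rightarrow> real) \<Rightarrow> bool" where
  "weighted_bundle K a \<longleftrightarrow> is_bundle G R K \<and> finite K \<and> (\<forall>T\<in>K. 0 \<le> a T)"

lemma weighted_bundleD:
  assumes "weighted_bundle K a"
  shows "finite K" "T \<in> K \<Longrightarrow> T \<in> trails G" "T \<in> K \<Longrightarrow> 0 \<le> a T"
  using assms by (auto simp: weighted_bundle_def is_bundle_def)

lemma weight_nonneg: "weighted_bundle K a \<Longrightarrow> 0 \<le> weight K a t"
  by (auto simp: weight_def weighted_bundle_def tocc_def occ_nonneg intro!: sum_nonneg mult_nonneg_nonneg add_nonneg_nonneg)

lemma weight_single:
  assumes "weighted_bundle K a"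
  shows "weight K a [\<alpha>] = (\<Sum>T\<in>K. a T * trail_vec T (fst \<alpha>))"
  using weighted_bundleD [OF assms] by (simp add: weight_def tocc_single)

lemma weight_snoc:
  assumes "weighted_bundle K a" "t \<noteq> []" "internal (other_half (last t))"
  shows "(\<Sum>\<beta>\<in>opposite (other_half (last t)). weight K a (t @ [\<beta>])) = weight K a t"
proof -
  have "tocc T t = (\<Sum>\<beta>\<in>opposite (other_half (last t)). tocc T (t @ [\<beta>]))" if "T \<in> K" for T
    unfolding tocc_def sum.distrib
    using trail_word_rep trail_word_inv weighted_bundleD(2) [OF assms(1) that] assms(2,3)
    by (simp flip: occ_snoc)
  then show ?thesis
    unfolding weight_def by (subst sum.swap) (simp add: sum_distrib_left)
qed

lemma weight_Cons:
  assumes "weighted_bundle K a" "t \<noteq> []" "internal (hd t)"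
  shows "(\<Sum>h\<in>opposite (hd t). weight K a (other_half h # t)) = weight K a t"
proof -
  have "tocc T t = (\<Sum>h\<in>opposite (hd t). tocc T (other_half h # t))" if "T \<in> K" for T
    unfolding tocc_def sum.distrib
    using trail_word_rep trail_word_inv weighted_bundleD(2) [OF assms(1) that] assms(2,3)
    by (simp flip: occ_Cons)
  then show ?thesis
    unfolding weight_def by (subst sum.swap) (simp add: sum_distrib_left)
qed

lemma weight_nonzero:
  assumes "weighted_bundle K a" "weight K a t \<noteq> 0"
  obtains T where "T \<in> K" "t \<in> substrings G T"
proof -
  obtain T where "T \<in> K" "tocc T t \<noteq> 0"
    using assms(2) unfolding weight_def by (auto elim!: sum.not_neutral_contains_not_neutral)
  then show ?thesis
    using that [of T] tocc_substring [OF weighted_bundleD(2) [OF assms(1)]] by blast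
qed

text \<open>Nonzero weights come from trails of the bundle that contain the two strings, and these
  strings would form an incompatibility. The two trails may coincide, so compatibility of a trail
  with itself enters as well.\<close>

lemma weight_staircase:
  assumes "weighted_bundle K a"
    and "frame_less G R h h'" "frame_less G R g g'"
  shows "weight K a (other_half h # s @ [g]) = 0 \<or> weight K a (other_half h' # s @ [g']) = 0"
proof (rule ccontr)
  assume "\<not> ?thesis"
  then have *: "weight K a (other_half h # s @ [g]) \<noteq> 0" "weight K a (other_half h' # s @ [g']) \<noteq> 0"
    by simp_all
  obtain T where T: "T \<in> K" "other_half h # s @ [g] \<in> substrings G T"
    by (rule weight_nonzero [OF assms(1) *(1)])
  obtain U where U: "U \<in> K" "other_half h' # s @ [g'] \<in> substrings G U"
    by (rule weight_nonzero [OF assms(1) *(2)])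
  have "incompatibility G R (other_half h # s @ [g]) (other_half h' # s @ [g'])"
    unfolding incompatibility_def
    by (rule exI [of _ "other_half h"], rule exI [of _ "other_half h'"], rule exI [of _ s])
      (use assms(2,3) is_string_substring [OF T(2)] in auto)
  then have "incompatible G R T U"
    using T U unfolding incompatible_def by blast
  then show False
    using assms(1) T U by (auto simp: weighted_bundle_def is_bundle_def)
qed

text \<open>With the middle \<open>s\<close> fixed, the weights of its two-sided extensions form a
  staircase matrix whose row and column sums are the weights of one-sided extensions. The remaining
  conclusions say that all marginals in the formula belong to strings, as an induction on the length
  requires. Taking \<open>hd\<close> and \<open>last\<close> of extended words covers the lazy
  middle.\<close>

lemma weight_step:
  fixes \<alpha> \<beta> s
  defines "C \<equiv> opposite (hd (s @ [\<beta>]))" and "D \<equiv> opposite (other_half (last (\<alpha> # s)))"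
  defines "L \<equiv> {x \<in> C. frame_less G R x (other_half \<alpha>)}" and "U \<equiv> {y \<in> D. frame_less G R \<beta> y}"
  defines "L' \<equiv> insert (other_half \<alpha>) L" and "U' \<equiv> insert \<beta> U"
  assumes K: "weighted_bundle K a" and s: "is_string G (\<alpha> # s @ [\<beta>])"
  defines "r \<equiv> \<lambda>h. weight K a (other_half h # s)" and "c \<equiv> \<lambda>g. weight K a (s @ [g])"
  shows "weight K a (\<alpha> # s @ [\<beta>])
    = min (sum r L') (sum c U') - min (sum r L) (sum c U')
     - min (sum r L') (sum c U) + min (sum r L) (sum c U)"
    and "L' \<subseteq> C" "U' \<subseteq> D"
    and "h \<in> C \<Longrightarrow> is_string G (other_half h # s)" "g \<in> D \<Longrightarrow> is_string G (s @ [g])"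
proof -
  let ?x = "hd (s @ [\<beta>])" and ?y = "other_half (last (\<alpha> # s))"
  have half: "\<alpha> \<in> half_edges G" "\<beta> \<in> half_edges G" "set s \<subseteq> half_edges G"
    using s by (auto simp: is_string_def)
  have xy: "?x \<in> half_edges G" "?y \<in> half_edges G"
    using half by (cases s; simp; fail) (use half in \<open>cases s rule: rev_cases; simp\<close>)
  have comp: "composable G \<alpha> ?x" "composable G (last (\<alpha> # s)) \<beta>"
    using s by (cases s; simp add: is_string_def)
      (use s in \<open>simp add: is_string_def successively_append_iff flip: append_Cons\<close>)
  have x: "internal ?x" "other_half \<alpha> \<in> C"
    using comp(1) xy half opposite_sym [of "other_half \<alpha>" ?x] internal_opposite
    by (auto simp: composable_iff C_def)
  have y: "internal ?y" "\<beta> \<in> D"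
    using comp(2) half by (simp_all add: composable_iff D_def)
  show "L' \<subseteq> C" "U' \<subseteq> D"
    using x y by (auto simp: L_def L'_def U_def U'_def)
  have opp_C: "opposite h = opposite (other_half \<alpha>)" if "h \<in> C" for h
    using opposite_cong xy x that unfolding C_def by blast
  have opp_D: "opposite g = opposite \<beta>" if "g \<in> D" for g
    using opposite_cong xy y that unfolding D_def by blast
  have C: "h \<in> half_edges G" "internal h" if "h \<in> C" for h
    using that x opposite_subset internal_opposite unfolding C_def by blast+
  have D: "h \<in> half_edges G" "internal h" if "h \<in> D" for h
    using that y opposite_subset internal_opposite unfolding D_def by blast+
  have sub: "is_string G s"
    using s by (rule is_string_sublist) (use sublist_appendI [of s "[\<alpha>]" "[\<beta>]"] in simp)
  show "is_string G (other_half h # s)" if "h \<in> C" for h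
  proof (cases s)
    case (Cons z s')
    have "?x \<in> opposite h"
      using opp_C [OF that] comp(1) xy by (simp add: composable_iff)
    then show ?thesis
      using sub C [OF that] xy unfolding Cons by (simp add: is_string_def composable_iff)
  qed (use C [OF that] in \<open>simp add: is_string_def\<close>)
  show "is_string G (s @ [g])" if "g \<in> D" for g
  proof (cases "s = []")
    case False
    have "composable G (last s) g"
      using D [OF that] y that False by (simp add: composable_iff D_def)
    then show ?thesis
      using sub D [OF that] by (simp add: is_string_def successively_append_iff)
  qed (use D [OF that] in \<open>simp add: is_string_def\<close>)
  \<comment> \<open>The rows are indexed by head half-edges, so \<alpha> appears as
    \<open>other_half\<close> of its own head.\<close>
  have "weight K a (other_half (other_half \<alpha>) # s @ [\<beta>])
    = min (sum r L') (sum c U') - min (sum r L) (sum c U')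
     - min (sum r L') (sum c U) + min (sum r L) (sum c U)"
    unfolding L'_def U'_def
  proof (rule staircase_entry [where C = C and D = D and lt = "frame_less G R" and lt' = "frame_less G R"])
    show "(\<Sum>g\<in>D. weight K a (other_half h # s @ [g])) = r h" if "h \<in> C" for h
    proof -
      have *: "opposite (other_half (last (other_half h # s))) = D"
        using opp_C [OF that] by (cases "s = []") (simp_all add: D_def)
      have "internal (other_half (last (other_half h # s)))"
        using C [OF that] y by (cases "s = []") simp_all
      from weight_snoc [OF K _ this] show ?thesis
        unfolding * r_def by simp
    qed
    show "(\<Sum>h\<in>C. weight K a (other_half h # s @ [g])) = c g" if "g \<in> D" for g
    proof -
      \<comment> \<open>For a lazy middle the first letter is \<open>g\<close> itself, and all
        elements of \<open>D\<close> have the same opposite class.\<close>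
      have "hd (s @ [g]) = (if s = [] then g else ?x)"
        by simp
      then have "opposite (hd (s @ [g])) = C" "internal (hd (s @ [g]))"
        using opp_D [OF that] D [OF that] x by (auto simp: C_def)
      with weight_Cons [OF K, of "s @ [g]"] show ?thesis
        unfolding c_def by simp
    qed
    show "weight K a (other_half h # s @ [g]) = 0 \<or> weight K a (other_half h' # s @ [g']) = 0"
      if "frame_less G R h h'" "frame_less G R g g'" for h h' g g'
      using weight_staircase [OF K that] .
  qed (use x y xy frame_less_on_opposite transp_on_frame_less weight_nonneg [OF K] in
      \<open>simp_all add: L_def U_def C_def D_def\<close>)
  then show "weight K a (\<alpha> # s @ [\<beta>])
    = min (sum r L') (sum c U') - min (sum r L) (sum c U')
     - min (sum r L') (sum c U) + min (sum r L) (sum c U)"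
    by simp
qed

lemma string_cases:
  fixes t :: "'a list"
  assumes "t \<noteq> []"
  obtains \<alpha> where "t = [\<alpha>]" | \<alpha> s \<beta> where "t = \<alpha> # s @ [\<beta>]"
  using assms by (cases t; cases "tl t" rule: rev_cases) auto

lemma weight_unique:
  assumes K: "weighted_bundle K a" and L: "weighted_bundle L b"
    and single: "\<And>\<alpha>. \<alpha> \<in> half_edges G \<Longrightarrow> weight K a [\<alpha>] = weight L b [\<alpha>]"
    and "is_string G t" "t \<noteq> []"
  shows "weight K a t = weight L b t"
  using assms(4,5)
proof (induction t rule: length_induct)
  case (1 t)
  from 1(3) show ?case
  proof (cases t rule: string_cases)
    case (1 \<alpha>)
    then show ?thesis
      using single \<open>is_string G t\<close> by (simp add: is_string_def)
  next
    case (2 \<alpha> s \<beta>)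
    then have s: "is_string G (\<alpha> # s @ [\<beta>])"
      using 1(2) by simp
    note 3 = weight_step [OF K s]
    have IH: "weight K a u = weight L b u" if "length u < length t" "is_string G u" "u \<noteq> []" for u
      using 1(1) that by blast
    have r: "weight K a (other_half h # s) = weight L b (other_half h # s)"
      if "h \<in> opposite (hd (s @ [\<beta>]))" for h
      using 3(4) [OF that] 2 by (intro IH) simp_all
    have c: "weight K a (s @ [g]) = weight L b (s @ [g])"
      if "g \<in> opposite (other_half (last (\<alpha> # s)))" for g
      using 3(5) [OF that] 2 by (intro IH) simp_all
    show ?thesis
      unfolding 2 3(1) weight_step(1) [OF L s]
      using 3(2,3) by (intro arg_cong2 [of _ _ _ _ "(+)"] arg_cong2 [of _ _ _ _ "(-)"]
        arg_cong2 [of _ _ _ _ min] sum.cong refl r c) blast+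
  qed
qed

text \<open>The entry formula is built from sums, differences and minima of marginals, and the
  integers are closed under these.\<close>

lemma weight_Ints:
  assumes K: "weighted_bundle K a"
    and single: "\<And>\<alpha>. \<alpha> \<in> half_edges G \<Longrightarrow> weight K a [\<alpha>] \<in> \<int>"
    and "is_string G t" "t \<noteq> []"
  shows "weight K a t \<in> \<int>"
  using assms(3,4)
proof (induction t rule: length_induct)
  case (1 t)
  from 1(3) show ?case
  proof (cases t rule: string_cases)
    case (1 \<alpha>)
    then show ?thesis
      using single \<open>is_string G t\<close> by (simp add: is_string_def)
  next
    case (2 \<alpha> s \<beta>)
    then have s: "is_string G (\<alpha> # s @ [\<beta>])"
      using 1(2) by simp
    note 3 = weight_step [OF K s]
    have IH: "weight K a u \<in> \<int>" if "length u < length t" "is_string G u" "u \<noteq> []" for u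
      using 1(1) that by blast
    have r: "weight K a (other_half h # s) \<in> \<int>" if "h \<in> opposite (hd (s @ [\<beta>]))" for h
      using 3(4) [OF that] 2 by (intro IH) simp_all
    have c: "weight K a (s @ [g]) \<in> \<int>" if "g \<in> opposite (other_half (last (\<alpha> # s)))" for g
      using 3(5) [OF that] 2 by (intro IH) simp_all
    show ?thesis
      unfolding 2 3(1)
      using 3(2,3) by (intro Ints_add Ints_diff Ints_min Ints_sum r c) blast+
  qed
qed

section \<open>Strings that detect a single trail\<close>

lemma occurs_at_unique:
  assumes "\<And>i. i < length w \<Longrightarrow> occurs_at w i t \<longleftrightarrow> i = 0 \<and> P" "w \<noteq> []"
  shows "occ w t = of_bool P"
proof -
  have "occ w t = (\<Sum>i<length w. if i = 0 then of_bool P else 0)"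
    unfolding occ_def using assms(1) by (intro sum.cong) auto
  also have "\<dots> = of_bool P"
    using assms(2) by (subst sum.delta) auto
  finally show ?thesis .
qed

text \<open>A route starts and ends at fringe half-edges, so nothing can precede or follow it inside
  a trail: it fills the whole word.\<close>

lemma occ_route:
  assumes "trail_word w" "is_route G p"
  shows "occ w p = of_bool (w = p)"
proof (rule occurs_at_unique)
  have p: "p \<noteq> []"
    using assms(2) by (simp add: is_route_def)
  show "w \<noteq> []"
    using assms(1) by (rule trail_word_nonempty)
  fix i assume i: "i < length w"
  show "occurs_at w i p \<longleftrightarrow> i = 0 \<and> w = p"
  proof
    assume occ: "occurs_at w i p"
    then have hd: "letter w i = Some (hd p)"
      using p by (cases p) simp_all
    have "i = 0"
    proof (rule ccontr)
      assume "i \<noteq> 0"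
      then obtain i' where i': "i = Suc i'"
        by (cases i) auto
      obtain \<alpha> where "letter w i' = Some \<alpha>"
        using letter_pred_exists hd unfolding i' by blast
      then show False
        using letter_in_opposite(4) [OF assms(1) _ hd [unfolded i']] route_ends(1) [OF assms(2)] by blast
    qed
    have "\<not> is_band G w"
    proof
      assume "is_band G w"
      \<comment> \<open>Position 0 of a band has a predecessor too, seen by reading it as position
        \<open>length w\<close>.\<close>
      then have "letter w (Suc (length w - 1)) = Some (hd p)"
        using hd i \<open>i = 0\<close> by (simp add: letter_def)
      moreover from this obtain \<alpha> where "letter w (length w - 1) = Some \<alpha>"
        by (rule letter_pred_exists)
      ultimately show False
        using letter_in_opposite(4) [OF assms(1)] route_ends(1) [OF assms(2)] by blast
    qed
    then have nth: "j < length w \<and> w ! j = p ! j" if "j < length p" for j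
      using occ that \<open>i = 0\<close> by (auto simp: occurs_at_def letter_def split: if_splits)
    have le: "length p \<le> length w"
      using nth [of "length p - 1"] p by (cases p) auto
    have "length p = length w"
    proof (rule ccontr)
      assume "length p \<noteq> length w"
      then have "letter w (Suc (length p - 1)) = Some (w ! length p)"
        using le p \<open>\<not> is_band G w\<close> by (simp add: letter_def)
      moreover have "letter w (length p - 1) = Some (last p)"
        using p nth [of "length p - 1"] \<open>\<not> is_band G w\<close> by (simp add: letter_def last_conv_nth)
      ultimately show False
        using letter_in_opposite(3) [OF assms(1)] route_ends(2) [OF assms(2)] by blast
    qed
    then show "i = 0 \<and> w = p"
      using nth \<open>i = 0\<close> by (auto intro: nth_equalityI)
  next
    assume "i = 0 \<and> w = p"
    then show "occurs_at w i p"
      using assms(2) is_band_not_route by (auto simp: occurs_at_def letter_def)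
  qed
qed

lemma is_band_power:
  assumes "is_band G B" "B = string_power z a"
  shows "a = 1"
proof -
  have "a \<noteq> 0"
    using assms by (cases a) (auto simp: is_band_def)
  then have "sublist z (B @ B)"
    unfolding assms(2) by (cases a) auto
  then have "is_string G z"
    using assms(1) is_string_sublist by (auto simp: is_band_def)
  then have "\<not> a \<ge> 2"
    using assms by (auto simp: is_band_def)
  with \<open>a \<noteq> 0\<close> show ?thesis
    by simp
qed

text \<open>Commuting words are powers of a common word, and for bands both exponents are 1.\<close>

lemma is_band_commute:
  assumes "is_band G B" "is_band G u" "B @ u = u @ B"
  shows "B = u"
proof -
  obtain m n z where B: "string_power z m = B" and u: "string_power z n = u"
    using comm_append_are_replicate [OF assms(3)] by (auto simp: concat_replicate_power)
  have "m = 1" "n = 1"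
    using is_band_power assms(1,2) B u by blast+
  then show ?thesis
    using B u by simp
qed

text \<open>A nontrivial rotation fixing \<open>B\<close> would cut it into two commuting factors
  and make it a proper power. Hence a high power of a band starts only once per period of that
  band.\<close>

lemma is_band_rotate_eq:
  assumes "is_band G B" "rotate i B = B" "i < length B"
  shows "i = 0"
proof -
  have "take i B @ drop i B = drop i B @ take i B"
    using assms(2,3) by (simp add: rotate_drop_take)
  then obtain m n z where *: "string_power z m = take i B" "string_power z n = drop i B"
    using comm_append_are_replicate by (metis concat_replicate_power)
  then have "B = string_power z (m + n)"
    by (simp add: string_power_add)
  then have "m + n = 1"
    using is_band_power assms(1) by blast
  moreover have "n \<noteq> 0"
    using *(2) assms(3) by (cases n) auto
  ultimately have "m = 0"
    by simp
  then show ?thesis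
    using *(1) assms(3) by auto
qed

text \<open>Otherwise \<open>B\<close> would split into two words equal to their own inverses, one
  of them nonempty, and no nonempty string is of this kind. So the reversed reading of a band
  contributes nothing to the string that detects it.\<close>

lemma rotate_inv_string_neq:
  assumes "is_band G B"
  shows "rotate i (inv_string B) \<noteq> B"
proof
  assume *: "rotate i (inv_string B) = B"
  define j where "j = i mod length B"
  define x where "x = take j (inv_string B)"
  define y where "y = drop j (inv_string B)"
  have B: "B = y @ x"
    using * by (simp add: rotate_drop_take x_def y_def j_def)
  have "inv_string B = x @ y"
    by (simp add: x_def y_def)
  then have "inv_string x @ inv_string y = x @ y"
    by (simp add: B)
  then have "inv_string x = x" "inv_string y = y"
    by (simp_all add: append_eq_append_conv)
  moreover have "is_string G (B @ B)" "B \<noteq> []"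
    using assms by (simp_all add: is_band_def)
  moreover from this(1) have "is_string G x" "is_string G y"
    unfolding B by (auto elim!: is_string_sublist)
  ultimately show False
    using string_not_palindrome B by auto
qed

text \<open>
  A weak form of the theorem of Fine and Wilf: a word with two periods whose length is at least
  their sum has commuting period words.
\<close>

lemma occurs_at_band_power:
  assumes "trail_word w" "i < length w" "length w < k" "is_band G B"
  shows "occurs_at w i (string_power B k) \<longleftrightarrow> is_band G w \<and> rotate i w = B"
proof
  define n where "n = length B"
  define m where "m = length w"
  define t where "t = string_power B k"
  have n: "n > 0"
    using assms(4) by (simp add: is_band_def n_def)
  have k: "k = Suc (k - 1)" "m \<le> k - 1"
    using assms(3) by (simp_all add: m_def)
  \<comment> \<open>An exponent above \<open>length w\<close> makes the power at least
    \<open>n + m\<close> long, the sum of the two periods.\<close>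
  have "k - 1 \<le> (k - 1) * n"
    using n by simp
  with k(2) have "m \<le> (k - 1) * n"
    by (rule le_trans)
  moreover have "length t = n + (k - 1) * n"
    unfolding t_def n_def by (subst k(1)) simp
  ultimately have len: "n + m \<le> length t"
    by linarith
  have m: "m > 0"
    using assms(2) unfolding m_def by linarith
  have t: "t ! j = B ! (j mod n)" if "j < length t" for j
    using that nth_string_power unfolding t_def n_def by simp
  {
    assume occ: "occurs_at w i (string_power B k)"
    have band: "is_band G w"
    proof (rule ccontr)
      assume "\<not> is_band G w"
      moreover have "letter w (i + (length t - 1)) \<noteq> None"
        using occ len m by (simp add: occurs_at_def t_def)
      ultimately have "length t \<le> m"
        by (auto simp: letter_def m_def split: if_splits)
      then show False
        using len n by simp
    qed
    define u where "u = rotate i w"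
    have u: "is_band G u" "length u = m"
      using is_band_rotate band by (simp_all add: u_def m_def)
    have tu: "t ! j = u ! (j mod m)" if "j < length t" for j
      using that occ m band
      by (simp add: occurs_at_def letter_def t_def u_def m_def nth_rotate mod_add_right_eq)
    \<comment> \<open>Both products are the prefix of \<open>t\<close> of length
      \<open>n + m\<close>, read once with a block of length \<open>n\<close> in front and once with
      a block of length \<open>m\<close>.\<close>
    have "B @ u = u @ B"
    proof (rule nth_equalityI)
      fix j assume "j < length (B @ u)"
      then have j: "j < n + m"
        by (simp add: n_def u)
      have "(B @ u) ! j = t ! j"
      proof (cases "j < n")
        case False
        then have "u ! (j - n) = t ! (j - n)"
          using tu [of "j - n"] j len by simp
        also have "\<dots> = t ! j"
          using t j len False by (simp add: le_mod_geq)
        finally show ?thesis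
          using False by (simp add: nth_append n_def)
      qed (use t j len in \<open>simp add: nth_append n_def\<close>)
      moreover have "(u @ B) ! j = t ! j"
      proof (cases "j < m")
        case False
        then have "B ! (j - m) = t ! (j - m)"
          using t [of "j - m"] j len by simp
        also have "\<dots> = t ! j"
          using tu j len False by (simp add: le_mod_geq)
        finally show ?thesis
          using False u by (simp add: nth_append)
      qed (use tu u j len in \<open>simp add: nth_append\<close>)
      ultimately show "(B @ u) ! j = (u @ B) ! j"
        by simp
    qed simp
    then have "B = u"
      using is_band_commute assms(4) u(1) by blast
    then show "is_band G w \<and> rotate i w = B"
      using band by (simp add: u_def)
  next
    assume *: "is_band G w \<and> rotate i w = B"
    then have "n = m"
      by (auto simp: n_def m_def)
    then have "letter w (i + j) = Some (t ! j)" if "j < length t" for j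
      using that * m t [OF that] by (auto simp: letter_def m_def nth_rotate mod_add_right_eq)
    then show "occurs_at w i (string_power B k)"
      by (simp add: occurs_at_def t_def)
  }
qed

text \<open>On such a string the weight is the coefficient of \<open>T\<close>. The value is 1 and
  not 2 because only one of the two orientations contributes.\<close>

lemma detecting_string:
  assumes "finite K" "K \<subseteq> trails G" "T \<in> K"
  obtains t where "is_string G t" "t \<noteq> []" "tocc T t = 1" "\<And>U. U \<in> K \<Longrightarrow> U \<noteq> T \<Longrightarrow> tocc U t = 0"
proof -
  have T: "T \<in> trails G"
    using assms by blast
  define p where "p = rep T"
  have p: "p \<in> T" "trail_word p" "p \<noteq> []"
    using rep_in trail_word_rep trail_word_nonempty T by (simp_all add: p_def)
  have U: "rep U \<in> U" "trail_word (rep U)" "inv_string (rep U) \<in> U" "trail_word (inv_string (rep U))"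
    if "U \<in> K" for U
  proof -
    have "U \<in> trails G"
      using that assms by blast
    then show "rep U \<in> U" "trail_word (rep U)" "inv_string (rep U) \<in> U" "trail_word (inv_string (rep U))"
      by (simp_all add: rep_in trail_word_rep inv_rep_in trail_word_inv)
  qed
  have not_in: "q \<notin> U" if "q \<in> T" "U \<in> K" "U \<noteq> T" for q U
    using trail_eq [OF T _ that(1)] that assms(2) by blast
  show ?thesis
  proof (cases "is_route G p")
    case True
    have "inv_string p \<noteq> p"
      using string_not_palindrome trail_word_string p by blast
    then have "tocc T p = 1"
      using occ_route [OF _ True] p(2) trail_word_inv [OF p(2)] by (simp add: tocc_def p_def)
    moreover have "tocc U p = 0" if "U \<in> K" "U \<noteq> T" for U
    proof -
      have "rep U \<noteq> p" "inv_string (rep U) \<noteq> p"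
        using not_in [OF p(1) that] U [OF that(1)] by auto
      then show ?thesis
        using occ_route [OF _ True] U [OF that(1)] by (simp add: tocc_def)
    qed
    ultimately show ?thesis
      using that trail_word_string p by blast
  next
    case False
    then have band: "is_band G p"
      using p(2) by (simp add: trail_word_def)
    \<comment> \<open>The exponent has to exceed the length of every word tested against the band;
      the sum of all lengths is a crude common bound.\<close>
    define k where "k = Suc (\<Sum>U\<in>K. length (rep U))"
    define t where "t = string_power p k"
    have k: "length (rep U) < k" if "U \<in> K" for U
      unfolding k_def using member_le_sum [of U K "\<lambda>U. length (rep U)"] assms(1) that
      by (simp add: less_Suc_eq_le)
    have "tocc T t = 1"
    proof -
      have "occ p t = of_bool True"
      proof (rule occurs_at_unique)
        fix i assume "i < length p"
        moreover have "length p < k"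
          using k [OF assms(3)] by (simp add: p_def)
        ultimately have "occurs_at p i t \<longleftrightarrow> rotate i p = p"
          using occurs_at_band_power [OF p(2) _ _ band] band by (simp add: t_def)
        then show "occurs_at p i t \<longleftrightarrow> i = 0 \<and> True"
          using is_band_rotate_eq [OF band] \<open>i < length p\<close> by auto
      qed (rule p)
      moreover have "occ (inv_string p) t = 0"
        unfolding occ_def
      proof (rule sum.neutral, rule ballI)
        fix i assume "i \<in> {..<length (inv_string p)}"
        then have "\<not> occurs_at (inv_string p) i t"
          using occurs_at_band_power [OF trail_word_inv [OF p(2)] _ _ band, of i k] k [OF assms(3)]
            rotate_inv_string_neq [OF band] by (simp add: t_def p_def)
        then show "of_bool (occurs_at (inv_string p) i t) = (0::real)"
          by simp
      qed
      ultimately show ?thesis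
        by (simp add: tocc_def flip: p_def)
    qed
    moreover have "tocc U t = 0" if "U \<in> K" "U \<noteq> T" for U
    proof -
      have "U \<in> trails G"
        using that assms by blast
      have "occ w t = 0" if w: "w = rep U \<or> w = inv_string (rep U)" for w
        unfolding occ_def
      proof (rule sum.neutral, rule ballI)
        fix i assume i: "i \<in> {..<length w}"
        have tw: "trail_word w" "length w < k"
          using w U [OF \<open>U \<in> K\<close>] k [OF \<open>U \<in> K\<close>] by auto
        have "\<not> (is_band G w \<and> rotate i w = p)"
        proof
          assume *: "is_band G w \<and> rotate i w = p"
          then have "is_band G (rep U)"
            using w is_band_inv [of w] by auto
          then have "rotate i w \<in> U"
            using w rotate_rep_in [OF \<open>U \<in> trails G\<close>] by auto
          then show False
            using * not_in [OF p(1) \<open>U \<in> K\<close> \<open>U \<noteq> T\<close>] by simp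
        qed
        then show "of_bool (occurs_at w i t) = (0::real)"
          using occurs_at_band_power [OF tw(1) _ tw(2) band] i by (simp add: t_def)
      qed
      then show ?thesis
        by (simp add: tocc_def)
    qed
    moreover have "is_string G t"
      unfolding t_def using band by (intro is_string_power) (simp add: is_band_def)
    moreover have "t \<noteq> []"
      using p(3) by (simp add: t_def k_def)
    ultimately show ?thesis
      using that by blast
  qed
qed

section \<open>Uniqueness and integrality of coefficients\<close>

lemma weight_detect:
  assumes "finite K" "T \<in> K" "tocc T t = 1" "\<And>U. U \<in> K \<Longrightarrow> U \<noteq> T \<Longrightarrow> tocc U t = 0"
  shows "weight K a t = a T"
proof -
  have "weight K a t = (\<Sum>U\<in>K. if U = T then a T else 0)"
    unfolding weight_def using assms(3,4) by (intro sum.cong) auto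
  then show ?thesis
    using assms(1,2) by simp
qed

text \<open>A representation may involve an infinite bundle; its support is a finite one, to which
  the weight arguments apply.\<close>

lemma represents_weight:
  assumes "represents G R K a F"
  defines "K' \<equiv> {T \<in> K. a T \<noteq> 0}"
  shows "weighted_bundle K' a" "weight K' a [\<alpha>] = F (fst \<alpha>)"
proof -
  show *: "weighted_bundle K' a"
    using assms by (auto simp: represents_def weighted_bundle_def is_bundle_def)
  show "weight K' a [\<alpha>] = F (fst \<alpha>)"
    unfolding weight_single [OF *] using assms(1) by (simp add: represents_def K'_def)
qed

lemma represents_unique:
  assumes K: "positively_represents G R K a F" and L: "positively_represents G R L b F"
  shows "K = L" "\<forall>T\<in>K. a T = b T"
proof -
  have sub: "K \<subseteq> L \<and> (\<forall>T\<in>K. a T = b T)"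
    if K: "positively_represents G R K a F" and L: "positively_represents G R L b F" for K L a b
  proof -
    have K': "{T \<in> K. a T \<noteq> 0} = K" and L': "{T \<in> L. b T \<noteq> 0} = L"
      using K L by (auto simp: positively_represents_def)
    have rep: "represents G R K a F" "represents G R L b F"
      using K L by (simp_all add: positively_represents_def)
    note wK = represents_weight [OF rep(1), unfolded K'] and wL = represents_weight [OF rep(2), unfolded L']
    have eq: "weight K a t = weight L b t" if "is_string G t" "t \<noteq> []" for t
      by (rule weight_unique [OF wK(1) wL(1) _ that]) (simp add: wK(2) wL(2))
    have "T \<in> L \<and> a T = b T" if T: "T \<in> K" for T
    proof -
      have fin: "finite K" "finite L" "K \<union> L \<subseteq> trails G"
        using wK(1) wL(1) rep by (auto simp: weighted_bundle_def is_bundle_def)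
      \<comment> \<open>\<open>t\<close> is chosen to separate \<open>T\<close> from the trails of
        both bundles, since membership of \<open>T\<close> in \<open>L\<close> is still
        open.\<close>
      then obtain t where t: "is_string G t" "t \<noteq> []" "tocc T t = 1"
          "\<And>U. U \<in> K \<union> L \<Longrightarrow> U \<noteq> T \<Longrightarrow> tocc U t = 0"
        using detecting_string [of "K \<union> L" T] T by blast
      have aT: "weight K a t = a T"
        by (rule weight_detect [OF fin(1) T t(3)]) (rule t(4); simp)
      \<comment> \<open>Without \<open>T\<close> every trail of \<open>L\<close> would contribute 0
        on \<open>t\<close>, against the positivity of \<open>a T\<close>.\<close>
      then have "weight L b t > 0"
        using eq [OF t(1,2)] K T by (simp add: positively_represents_def)
      then have "T \<in> L"
      proof (rule contrapos_pp)
        assume "T \<notin> L"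
        then have "tocc U t = 0" if "U \<in> L" for U
          using t(4) [of U] that by blast
        then show "\<not> weight L b t > 0"
          by (simp add: weight_def)
      qed
      then have "weight L b t = b T"
        by (rule weight_detect [OF fin(2) _ t(3)]) (rule t(4); simp)
      with \<open>T \<in> L\<close> show ?thesis
        using aT eq [OF t(1,2)] by simp
    qed
    then show ?thesis
      by blast
  qed
  show "K = L" "\<forall>T\<in>K. a T = b T"
    using sub [OF K L] sub [OF L K] by blast+
qed

lemma represents_Ints:
  assumes "represents G R K a F" "\<forall>e\<in>edges G. F e \<in> \<int>" "T \<in> K"
  shows "a T \<in> \<int>"
proof (cases "a T = 0")
  case False
  define K' where "K' = {T \<in> K. a T \<noteq> 0}"
  note w = represents_weight [OF assms(1), folded K'_def]
  have "finite K'" "K' \<subseteq> trails G" "T \<in> K'"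
    using w(1) assms(3) False by (auto simp: weighted_bundle_def is_bundle_def K'_def)
  moreover from this obtain t where t: "is_string G t" "t \<noteq> []" "tocc T t = 1"
      "\<And>U. U \<in> K' \<Longrightarrow> U \<noteq> T \<Longrightarrow> tocc U t = 0"
    using detecting_string [of K' T] by blast
  ultimately have "weight K' a t = a T"
    using weight_detect [of K' T t] by blast
  moreover have "weight K' a t \<in> \<int>"
  proof (rule weight_Ints [OF w(1) _ t(1,2)])
    show "weight K' a [\<alpha>] \<in> \<int>" if "\<alpha> \<in> half_edges G" for \<alpha>
      using that assms(2) unfolding w(2) by (auto simp: half_edges_def)
  qed
  ultimately show ?thesis
    by simp
qed simp

end

section \<open>Strands\<close>

lemma rank_bij:
  assumes "finite Z" "transp lt" "irreflp lt" "totalp_on Z lt"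
  shows "bij_betw (\<lambda>z. card {y \<in> Z. lt y z}) Z {..<card Z}"
    and "x \<in> Z \<Longrightarrow> y \<in> Z \<Longrightarrow> card {u \<in> Z. lt u x} < card {u \<in> Z. lt u y} \<longleftrightarrow> lt x y"
proof -
  let ?rank = "\<lambda>z. card {y \<in> Z. lt y z}"
  have mono: "?rank x < ?rank y" if "x \<in> Z" "lt x y" for x y
    using that assms(1) transpD [OF assms(2) _ that(2)] irreflpD [OF assms(3), of x]
    by (intro psubset_card_mono) auto
  have iff: "?rank x < ?rank y \<longleftrightarrow> lt x y" if "x \<in> Z" "y \<in> Z" for x y
    using mono [of x y] mono [of y x] that totalp_onD [OF assms(4) that] by force
  then show "x \<in> Z \<Longrightarrow> y \<in> Z \<Longrightarrow> ?rank x < ?rank y \<longleftrightarrow> lt x y" .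
  have inj: "inj_on ?rank Z"
  proof (rule inj_onI)
    fix x y assume "x \<in> Z" "y \<in> Z" "?rank x = ?rank y"
    then show "x = y"
      using mono [of x y] mono [of y x] totalp_onD [OF assms(4), of x y] by force
  qed
  have "?rank z < card Z" if "z \<in> Z" for z
    using assms(1) that irreflpD [OF assms(3), of z] by (intro psubset_card_mono) auto
  then have "?rank ` Z = {..<card Z}"
    using card_image [OF inj] by (intro card_subset_eq) auto
  with inj show "bij_betw ?rank Z {..<card Z}"
    by (simp add: bij_betw_def)
qed

text \<open>Elements are matched by rank, counted from opposite ends.\<close>

lemma antitone_bijection:
  assumes fin: "finite X" "finite Y" and card: "card X = card Y"
    and lt: "transp lt" "irreflp lt" "totalp_on X lt" "totalp_on Y lt"
  obtains f where "bij_betw f X Y" "\<And>x x'. x \<in> X \<Longrightarrow> x' \<in> X \<Longrightarrow> lt x x' \<Longrightarrow> lt (f x') (f x)"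
proof -
  define rX where "rX = (\<lambda>z. card {y \<in> X. lt y z})"
  define rY where "rY = (\<lambda>z. card {y \<in> Y. lt y z})"
  define n where "n = card X"
  note X = rank_bij [OF fin(1) lt(1-3), folded rX_def n_def]
  note Y = rank_bij [OF fin(2) lt(1,2,4), folded rY_def, folded card, folded n_def]
  define f where "f = inv_into Y rY \<circ> ((\<lambda>k. n - 1 - k) \<circ> rX)"
  have "bij_betw (\<lambda>k. n - 1 - k) {..<n} {..<n}"
    by (rule bij_betw_byWitness [where f' = "\<lambda>k. n - 1 - k"]) auto
  with X(1) have "bij_betw ((\<lambda>k. n - 1 - k) \<circ> rX) X {..<n}"
    by (rule bij_betw_trans)
  then have f: "bij_betw f X Y"
    unfolding f_def using bij_betw_inv_into [OF Y(1)] by (rule bij_betw_trans)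
  have rank: "rX x < n \<and> rY (f x) = n - 1 - rX x" if "x \<in> X" for x
  proof -
    have "rX x < n"
      using that X(1) by (auto simp: bij_betw_def)
    moreover from this have "n - 1 - rX x \<in> rY ` Y"
      using Y(1) by (auto simp: bij_betw_def)
    ultimately show ?thesis
      by (simp add: f_def f_inv_into_f)
  qed
  have "lt (f x') (f x)" if "x \<in> X" "x' \<in> X" "lt x x'" for x x'
  proof -
    have "f x \<in> Y" "f x' \<in> Y"
      using f that by (auto simp: bij_betw_def)
    moreover have "rY (f x') < rY (f x)"
    proof -
      have "rX x < rX x'"
        using X(2) [OF that(1,2)] that(3) by (simp add: rX_def)
      then show ?thesis
        using rank [OF that(1)] rank [OF that(2)] by linarith
    qed
    ultimately show ?thesis
      using Y(2) by (simp add: rY_def)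
  qed
  with f show ?thesis
    by (rule that)
qed

context framed_chart
begin

text \<open>
  A flow with values in the natural numbers is drawn as \<open>F e\<close> parallel strands along each edge
  \<open>e\<close>.  The strands are numbered at each of the two half-edges, in opposite directions.
\<close>

definition strands :: "('e \<Rightarrow> nat) \<Rightarrow> 'e half_edge set \<Rightarrow> ('e half_edge \<times> nat) set" where
  "strands F A = (SIGMA h:A. {..<F (fst h)})"

text \<open>Lexicographic, and local: strands at half-edges of different classes are
  incomparable.\<close>

definition strand_less :: "'e half_edge \<times> nat \<Rightarrow> 'e half_edge \<times> nat \<Rightarrow> bool" where
  "strand_less x y \<longleftrightarrow> frame_less G R (fst x) (fst y) \<or> fst x = fst y \<and> snd x < snd y"

lemma transp_strand_less: "transp strand_less"
proof (rule transpI)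
  fix x y z assume *: "strand_less x y" "strand_less y z"
  show "strand_less x z"
    using * frame_less_trans [of "fst x" "fst y" "fst z"] unfolding strand_less_def by auto
qed

lemma irreflp_strand_less: "irreflp strand_less"
  by (auto simp: irreflp_def strand_less_def frame_less_irrefl)

lemma totalp_on_strand_less: "totalp_on A (frame_less G R) \<Longrightarrow> totalp_on (strands F A) strand_less"
  by (fastforce simp: totalp_on_def strand_less_def strands_def)

lemma in_strands: "x \<in> strands F A \<longleftrightarrow> fst x \<in> A \<and> snd x < F (fst (fst x))"
  by (cases x) (simp add: strands_def)

lemma finite_strands: "finite A \<Longrightarrow> finite (strands F A)"
  by (simp add: strands_def)

lemma card_strands: "finite A \<Longrightarrow> card (strands F A) = (\<Sum>h\<in>A. F (fst h))"
  by (simp add: strands_def)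

lemma frame_less_same_class:
  assumes "frame_less G R h g" "internal_vertex G v" "C \<in> vclasses G v" "h \<in> C \<or> g \<in> C"
  shows "h \<in> C" "g \<in> C"
proof -
  obtain v' C' where *: "internal_vertex G v'" "C' \<in> vclasses G v'" "h \<in> C'" "g \<in> C'"
    using assms(1) by (auto simp: frame_less_def)
  then have "C' = C"
    using vclasses_unique [OF *(1,2) assms(2,3)] assms(4) by blast
  with * show "h \<in> C" "g \<in> C"
    by simp_all
qed

text \<open>The flow equation says that the two classes carry equally many strands. Gluing an
  antitone bijection between them with its inverse gives an involution.\<close>

lemma crossing_at_vertex:
  assumes "flow G (\<lambda>e. real (F e))" "internal_vertex G v"
  shows "\<exists>c. \<forall>x\<in>strands F (half_edges_at G v). c x \<in> strands F (opposite (fst x)) \<and> c (c x) = x \<and>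
    (\<forall>y\<in>strands F (half_edges_at G v). strand_less x y \<longrightarrow> strand_less (c y) (c x))"
proof -
  have "card (vclasses G v) = 2"
    using chart assms(2) by (simp add: turbulence_chart_def)
  then obtain A B where AB: "vclasses G v = {A, B}" "A \<noteq> B"
    by (auto simp: card_2_iff)
  note eq = equiv_vsim [OF assms(2)]
  have un: "A \<union> B = half_edges_at G v"
    using Union_quotient [OF eq] AB(1) by (simp add: vclasses_def)
  have disj: "A \<inter> B = {}"
    using quotient_disj [OF eq] AB unfolding vclasses_def by blast
  have fin: "finite A" "finite B"
    using un finite_half_edges_at by (metis finite_Un)+
  have opp: "opposite h = B" if "h \<in> A" for h
    using opposite_eq [OF assms(2) _ _ AB(2) that] AB(1) by simp
  have opp': "opposite h = A" if "h \<in> B" for h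
    using opposite_eq [OF assms(2) _ _ AB(2) [symmetric] that] AB(1) by simp
  have tot: "totalp_on C (frame_less G R)" if "C \<in> vclasses G v" for C
  proof -
    have "linear_order_on C (R C)"
      using framing assms(2) that by (simp add: framing_def)
    then show ?thesis
      using assms(2) that unfolding totalp_on_def frame_less_def linear_order_on_def total_on_def by blast
  qed
  have tot': "totalp_on (strands F A) strand_less" "totalp_on (strands F B) strand_less"
    using totalp_on_strand_less tot AB(1) by simp_all
  have "(\<Sum>h\<in>A. real (F (fst h))) = (\<Sum>h\<in>B. real (F (fst h)))"
    using assms AB(1) by (simp add: flow_def)
  then have card: "card (strands F A) = card (strands F B)"
    by (simp add: card_strands fin flip: of_nat_sum)
  obtain f where f: "bij_betw f (strands F A) (strands F B)"
    and anti: "\<And>x x'. x \<in> strands F A \<Longrightarrow> x' \<in> strands F A \<Longrightarrow> strand_less x x' \<Longrightarrow> strand_less (f x') (f x)"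
    using antitone_bijection [OF finite_strands [OF fin(1)] finite_strands [OF fin(2)] card
        transp_strand_less irreflp_strand_less tot'] by blast
  define g where "g = inv_into (strands F A) f"
  have g: "g y \<in> strands F A" "f (g y) = y" if "y \<in> strands F B" for y
    using f that bij_betw_inv_into_right [OF f that] bij_betwE [OF bij_betw_inv_into [OF f]]
    by (simp_all add: g_def)
  have fB: "f x \<in> strands F B" "g (f x) = x" if "x \<in> strands F A" for x
    using f that bij_betwE [OF f] bij_betw_inv_into_left [OF f that] by (simp_all add: g_def)
  \<comment> \<open>The inverse is antitone too, because the order on the strands of
    \<open>A\<close> is total.\<close>
  have anti': "strand_less (g y') (g y)" if "y \<in> strands F B" "y' \<in> strands F B" "strand_less y y'" for y y'
  proof (rule ccontr)
    assume "\<not> ?thesis"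
    then have "g y = g y' \<or> strand_less (g y) (g y')"
      using totalp_onD [OF tot'(1) g(1) [OF that(1)] g(1) [OF that(2)]] by blast
    then have "f (g y) = f (g y') \<or> strand_less (f (g y')) (f (g y))"
      using anti [OF g(1) [OF that(1)] g(1) [OF that(2)]] by auto
    then have "strand_less y y"
      using that(3) transpD [OF transp_strand_less that(3), of y] by (auto simp: g(2) that(1,2))
    then show False
      using irreflpD [OF irreflp_strand_less] by blast
  qed
  define c where "c x = (if fst x \<in> A then f x else g x)" for x
  have cases: "x \<in> strands F A \<or> x \<in> strands F B" if "x \<in> strands F (half_edges_at G v)" for x
    using that un by (auto simp: in_strands)
  have cA: "c x = f x" if "x \<in> strands F A" for x
    using that by (simp add: c_def in_strands)
  have cB: "c x = g x" if "x \<in> strands F B" for x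
    using that disj by (auto simp: c_def in_strands)
  have same: "x \<in> strands F A \<longleftrightarrow> y \<in> strands F A" "x \<in> strands F B \<longleftrightarrow> y \<in> strands F B"
    if "strand_less x y" "x \<in> strands F (half_edges_at G v)" "y \<in> strands F (half_edges_at G v)" for x y
    using that frame_less_same_class [OF _ assms(2), of "fst x" "fst y"] AB(1)
    by (auto simp: strand_less_def in_strands)
  show ?thesis
  proof (rule exI [of _ c], rule ballI, intro conjI ballI impI)
    fix x assume x: "x \<in> strands F (half_edges_at G v)"
    show "c x \<in> strands F (opposite (fst x))"
      using cases [OF x]
    proof
      assume *: "x \<in> strands F A"
      then have "fst x \<in> A"
        by (simp add: in_strands)
      then show ?thesis
        using fB(1) [OF *] opp by (simp add: cA [OF *])
    next
      assume *: "x \<in> strands F B"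
      then have "fst x \<in> B"
        by (simp add: in_strands)
      then show ?thesis
        using g(1) [OF *] opp' by (simp add: cB [OF *])
    qed
    show "c (c x) = x"
      using cases [OF x] by (auto simp: cA cB fB g)
    fix y assume y: "y \<in> strands F (half_edges_at G v)" and less: "strand_less x y"
    show "strand_less (c y) (c x)"
      using cases [OF x] same [OF less x y] anti [OF _ _ less] anti' [OF _ _ less] by (auto simp: cA cB)
  qed
qed

end

text \<open>Strands at fringe half-edges are fixed, so \<open>cross\<close> is an involution of all
  strands and a strand arriving at a fringe vertex is reflected. This makes the motion along strands
  a permutation.\<close>

locale crossing = framed_chart G R
  for G :: "('v, 'e) chart" and R :: "'e half_edge set \<Rightarrow> 'e half_edge rel" +
  fixes F :: "'e \<Rightarrow> nat" and cross :: "'e half_edge \<times> nat \<Rightarrow> 'e half_edge \<times> nat"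
  assumes cross_internal: "x \<in> strands F (half_edges G) \<Longrightarrow> internal (fst x) \<Longrightarrow>
      cross x \<in> strands F (opposite (fst x))"
    and cross_fringe: "x \<in> strands F (half_edges G) \<Longrightarrow> \<not> internal (fst x) \<Longrightarrow> cross x = x"
    and cross_cross: "x \<in> strands F (half_edges G) \<Longrightarrow> cross (cross x) = x"
    and cross_antimono: "x \<in> strands F (half_edges G) \<Longrightarrow> y \<in> strands F (half_edges G) \<Longrightarrow>
      internal (fst x) \<Longrightarrow> strand_less x y \<Longrightarrow> strand_less (cross y) (cross x)"
begin

section \<open>Reversible motion along the strands\<close>

abbreviation S :: "('e half_edge \<times> nat) set" where
  "S \<equiv> strands F (half_edges G)"

definition flip :: "'e half_edge \<times> nat \<Rightarrow> 'e half_edge \<times> nat" where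
  "flip x = (other_half (fst x), F (fst (fst x)) - 1 - snd x)"

definition step :: "'e half_edge \<times> nat \<Rightarrow> 'e half_edge \<times> nat" where
  "step x = cross (flip x)"

lemma finite_S: "finite S"
  by (simp add: finite_strands)

lemma fst_flip [simp]: "fst (flip x) = other_half (fst x)"
  by (simp add: flip_def)

lemma flip_in [simp]: "x \<in> S \<Longrightarrow> flip x \<in> S"
  by (auto simp: in_strands flip_def)

lemma flip_flip [simp]: "x \<in> S \<Longrightarrow> flip (flip x) = x"
  by (cases x) (auto simp: in_strands flip_def)

lemma flip_antimono:
  "x \<in> S \<Longrightarrow> y \<in> S \<Longrightarrow> fst x = fst y \<Longrightarrow> snd x < snd y \<Longrightarrow> strand_less (flip y) (flip x)"
  by (auto simp: in_strands flip_def strand_less_def)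

lemma cross_in [simp]:
  assumes "x \<in> S"
  shows "cross x \<in> S"
proof (cases "internal (fst x)")
  case True
  then have "cross x \<in> strands F (opposite (fst x))"
    using cross_internal assms by blast
  then show ?thesis
    using opposite_subset [of "fst x"] by (auto simp: in_strands)
qed (use assms cross_fringe in simp)

lemma step_in [simp]: "x \<in> S \<Longrightarrow> step x \<in> S"
  by (simp add: step_def)

text \<open>As \<open>cross\<close> and \<open>flip\<close> are involutions, conjugation by
  \<open>flip\<close> inverts \<open>step\<close>: running a strand backwards is again a motion
  along a strand.\<close>

lemma step_flip_step: "x \<in> S \<Longrightarrow> step (flip (step x)) = flip x"
  by (simp add: step_def cross_cross)

lemma bij_step: "bij_betw step S S"
  by (rule bij_betw_byWitness [where f' = "\<lambda>x. flip (step (flip x))"])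
    (auto simp: step_flip_step step_def cross_cross)

lemma step_opposite:
  "x \<in> S \<Longrightarrow> internal (other_half (fst x)) \<Longrightarrow> fst (step x) \<in> opposite (other_half (fst x))"
  using cross_internal [of "flip x"] flip_in [of x] by (simp add: step_def in_strands)

lemma step_fringe: "x \<in> S \<Longrightarrow> \<not> internal (other_half (fst x)) \<Longrightarrow> step x = flip x"
  using cross_fringe [of "flip x"] by (simp add: step_def)

text \<open>Passages have to be internal, which excludes the reflections at fringe vertices; these
  would not project to strings.\<close>

definition walk :: "('e half_edge \<times> nat) list \<Rightarrow> bool" where
  "walk xs \<longleftrightarrow> set xs \<subseteq> S \<and> successively (\<lambda>x y. internal (other_half (fst x)) \<and> y = step x) xs"

definition lifted :: "'e oriented_edge list \<Rightarrow> bool" where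
  "lifted t \<longleftrightarrow> (\<exists>xs. walk xs \<and> t = map fst xs)"

lemma lifted_sublist:
  assumes "lifted t" "sublist s t"
  shows "lifted s"
proof -
  obtain xs us vs where xs: "walk xs" "map fst xs = us @ s @ vs"
    using assms unfolding lifted_def sublist_def by metis
  then obtain as bs cs where "xs = as @ bs @ cs" "s = map fst bs"
    by (auto simp: map_eq_append_conv append_eq_map_conv)
  with xs(1) show ?thesis
    by (auto simp: lifted_def walk_def successively_append_iff)
qed

lemma lifted_inv_string:
  assumes "lifted t"
  shows "lifted (inv_string t)"
proof -
  obtain xs where xs: "walk xs" "t = map fst xs"
    using assms by (auto simp: lifted_def)
  have S: "set xs \<subseteq> S" and succ: "successively (\<lambda>x y. internal (other_half (fst x)) \<and> y = step x) xs"
    using xs(1) by (simp_all add: walk_def)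
  from succ have "successively (\<lambda>x y. internal (other_half (fst (flip y))) \<and> flip x = step (flip y)) xs"
  proof (rule successively_mono)
    fix x y assume "x \<in> set xs" "y \<in> set xs" and xy: "internal (other_half (fst x)) \<and> y = step x"
    then have "x \<in> S"
      using S by blast
    then show "internal (other_half (fst (flip y))) \<and> flip x = step (flip y)"
      using xy internal_opposite [OF step_opposite [of x]] step_flip_step [of x] by simp
  qed
  then have "walk (rev (map flip xs))"
    using xs(1) by (auto simp: walk_def successively_map)
  moreover have "inv_string t = map fst (rev (map flip xs))"
    by (simp add: inv_string_def xs(2) rev_map o_def)
  ultimately show ?thesis
    unfolding lifted_def by blast
qed

lemma lifted_is_string:
  assumes "lifted t"
  shows "is_string G t"
proof -
  obtain xs where xs: "walk xs" "t = map fst xs"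
    using assms by (auto simp: lifted_def)
  have half: "fst x \<in> half_edges G" if "x \<in> S" for x
    using that by (simp add: in_strands)
  have S: "set xs \<subseteq> S" and succ: "successively (\<lambda>x y. internal (other_half (fst x)) \<and> y = step x) xs"
    using xs(1) by (simp_all add: walk_def)
  from succ have "successively (\<lambda>x y. composable G (fst x) (fst y)) xs"
  proof (rule successively_mono)
    fix x y assume "x \<in> set xs" "y \<in> set xs" "internal (other_half (fst x)) \<and> y = step x"
    then show "composable G (fst x) (fst y)"
      using S step_opposite [of x] half [of y] by (auto simp: composable_iff)
  qed
  then show ?thesis
    using S half by (auto simp: is_string_def xs(2) successively_map)
qed

text \<open>
  Both \<open>flip\<close> and \<open>cross\<close> reverse the order of two strands, so their order at the head half-edges is
  preserved along a common string.
\<close>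

lemma walks_uncrossed:
  assumes "walk (x # xs @ [x'])" "walk (y # ys @ [y'])" "map fst xs = map fst ys"
    and "strand_less (flip x) (flip y)"
  shows "strand_less y' x'"
  using assms
proof (induction xs arbitrary: x y ys)
  case Nil
  then have S: "x \<in> S" "y \<in> S" "internal (other_half (fst x))" "x' = step x" "y' = step y"
    by (auto simp: walk_def)
  then show ?case
    using cross_antimono [of "flip x" "flip y"] Nil(4) by (simp add: step_def)
next
  case (Cons z xs)
  then obtain u us where ys: "ys = u # us" "fst u = fst z"
    by (cases ys) auto
  have S: "x \<in> S" "y \<in> S" "internal (other_half (fst x))" "z = step x" "u = step y" "z \<in> S" "u \<in> S"
    using Cons(2,3) by (auto simp: walk_def ys)
  then have "strand_less u z"
    using cross_antimono [of "flip x" "flip y"] Cons(5) by (simp add: step_def)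
  \<comment> \<open>Both strands now lie at the same half-edge, where only their numbers can
    differ.\<close>
  then have "snd u < snd z"
    using ys(2) frame_less_irrefl by (simp add: strand_less_def)
  then have "strand_less (flip z) (flip u)"
    using flip_antimono S ys(2) by blast
  moreover have "walk (z # xs @ [x'])" "walk (u # us @ [y'])"
    using Cons(2,3) by (auto simp: walk_def ys)
  ultimately show ?case
    using Cons(1) [of z u us] Cons(4) ys by simp
qed

text \<open>The order in which two strands enter a common string forces the reverse order of the
  tails at its end, whereas an incompatibility has the same order at both ends.\<close>

lemma lifted_compatible:
  assumes "lifted s" "lifted t"
  shows "\<not> incompatibility G R s t"
proof
  assume "incompatibility G R s t"
  then obtain \<alpha>\<^sub>1 \<alpha>\<^sub>2 u \<beta>\<^sub>1 \<beta>\<^sub>2 where *: "s = \<alpha>\<^sub>1 # u @ [\<beta>\<^sub>1]" "t = \<alpha>\<^sub>2 # u @ [\<beta>\<^sub>2]"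
    "frame_less G R (other_half \<alpha>\<^sub>1) (other_half \<alpha>\<^sub>2)" "frame_less G R \<beta>\<^sub>1 \<beta>\<^sub>2"
    unfolding incompatibility_def by blast
  obtain x xs x' where x: "walk (x # xs @ [x'])" "fst x = \<alpha>\<^sub>1" "map fst xs = u" "fst x' = \<beta>\<^sub>1"
    using assms(1) *(1) by (auto simp: lifted_def Cons_eq_map_conv append_eq_map_conv)
  obtain y ys y' where y: "walk (y # ys @ [y'])" "fst y = \<alpha>\<^sub>2" "map fst ys = u" "fst y' = \<beta>\<^sub>2"
    using assms(2) *(2) by (auto simp: lifted_def Cons_eq_map_conv append_eq_map_conv)
  have "strand_less (flip x) (flip y)"
    using *(3) x y by (simp add: strand_less_def)
  then have "strand_less y' x'"
    using walks_uncrossed [OF x(1) y(1)] x y by simp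
  moreover have "strand_less x' y'"
    using *(4) x y by (simp add: strand_less_def)
  ultimately have "strand_less x' x'"
    using transpD [OF transp_strand_less] by blast
  then show False
    using irreflpD [OF irreflp_strand_less] by blast
qed

end

section \<open>Decomposing a flow along its strands\<close>

lemma count_list_string_power: "count_list (string_power w k) x = k * count_list w x"
  by (induction k) simp_all

lemma map_string_power: "map f (string_power w k) = string_power (map f w) k"
  by (induction k) simp_all

text \<open>A shortest root works, since a proper root of it would be a still shorter root of
  \<open>w\<close>.\<close>

lemma primitive_root:
  assumes "w \<noteq> []"
  obtains B r where "w = string_power B r" "B \<noteq> []" "r \<noteq> 0"
    "\<And>s k. B = string_power s k \<Longrightarrow> k < 2"
proof -
  let ?P = "\<lambda>B. \<exists>r. w = string_power B r"
  have "?P w"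
    by (rule exI [of _ 1]) simp
  then obtain B where B: "?P B" "\<And>s. ?P s \<Longrightarrow> length B \<le> length s"
    using ex_has_least_nat [of ?P w length] by blast
  then obtain r where r: "w = string_power B r"
    by blast
  have ne: "B \<noteq> []" "r \<noteq> 0"
    using assms r by (auto simp: string_power_def)
  moreover have "k < 2" if k: "B = string_power s k" for s k
  proof (rule ccontr)
    assume "\<not> k < 2"
    have "w = string_power s (k * r)"
      unfolding r k by (rule string_power_mult)
    then have "length B \<le> length s"
      using B(2) by blast
    moreover have "length B = k * length s"
      using k by simp
    moreover have "2 * length s \<le> k * length s"
      using \<open>\<not> k < 2\<close> by simp
    ultimately have "length B = 0"
      by linarith
    then show False
      using ne by simp
  qed
  ultimately show ?thesis
    using r that by blast
qed

context crossing
begin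

section \<open>Orbits of strands and their trails\<close>

definition word :: "'e half_edge \<times> nat \<Rightarrow> nat \<Rightarrow> 'e oriented_edge list" where
  "word x n = map (\<lambda>k. fst ((step ^^ k) x)) [0..<n]"

lemma length_word [simp]: "length (word x n) = n"
  by (simp add: word_def)

lemma word_add: "word x (m + n) = word x m @ word ((step ^^ m) x) n"
proof (rule nth_equalityI)
  fix i assume "i < length (word x (m + n))"
  moreover have "(step ^^ (i - m)) ((step ^^ m) x) = (step ^^ i) x" if "m \<le> i"
    using funpow_add [of "i - m" m step] that by simp
  ultimately show "word x (m + n) ! i = (word x m @ word ((step ^^ m) x) n) ! i"
    by (simp add: word_def nth_append)
qed simp

lemma word_1: "word x (Suc 0) = [fst x]"
  by (simp add: word_def)

lemma funpow_step_in [simp]: "x \<in> S \<Longrightarrow> (step ^^ k) x \<in> S"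
  by (induction k) simp_all

lemma lifted_word:
  assumes "x \<in> S" "\<And>k. Suc k < n \<Longrightarrow> internal (other_half (fst ((step ^^ k) x)))"
  shows "lifted (word x n)"
proof -
  have "walk (map (\<lambda>k. (step ^^ k) x) [0..<n])"
    unfolding walk_def successively_conv_nth using assms by auto
  then show ?thesis
    unfolding lifted_def word_def by (rule exI [of _ "map (\<lambda>k. (step ^^ k) x) [0..<n]", OF conjI]) simp
qed

lemma word_period: "(step ^^ m) x = x \<Longrightarrow> string_power (word x m) k = word x (m * k)"
  by (induction k) (simp_all add: word_add, simp add: word_def)

lemma word_step:
  assumes "(step ^^ m) x = x"
  shows "count_list (map fst (word (step x) m)) e = count_list (map fst (word x m)) e"
proof -
  have "fst x # word (step x) m = word x m @ [fst x]"
    using word_add [of x 1 m] word_add [of x m 1] assms by (simp add: word_1)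
  then have "count_list (map fst (fst x # word (step x) m)) e = count_list (map fst (word x m @ [fst x])) e"
    by (simp only:)
  then show ?thesis
    by (simp split: if_splits)
qed

text \<open>With one period common to all strands, every orbit is read over the same number of steps
  and averages can be taken over all of \<open>S\<close> at once.\<close>

lemma period_exists:
  obtains m where "m > 0" "\<And>x. x \<in> S \<Longrightarrow> (step ^^ m) x = x"
proof -
  \<comment> \<open>By pigeonhole each strand has a return time of at most \<open>card S\<close>,
    and this divides the factorial.\<close>
  have "(step ^^ fact (card S)) x = x" if x: "x \<in> S" for x
  proof -
    have "\<not> inj_on (\<lambda>k. (step ^^ k) x) {..card S}"
    proof
      assume "inj_on (\<lambda>k. (step ^^ k) x) {..card S}"
      moreover have "(\<lambda>k. (step ^^ k) x) ` {..card S} \<subseteq> S"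
        using x by auto
      ultimately have "card {..card S} \<le> card S"
        using card_inj_on_le finite_S by blast
      then show False
        by simp
    qed
    then obtain i j where ij: "i < j" "j \<le> card S" "(step ^^ i) x = (step ^^ j) x"
      unfolding inj_on_def by (metis atMost_iff linorder_neqE_nat)
    define d where "d = j - i"
    have "(step ^^ i) ((step ^^ d) x) = (step ^^ i) x"
      using ij funpow_add [of i d step] by (simp add: d_def)
    moreover have "inj_on (step ^^ i) S"
      using bij_betw_funpow [OF bij_step] by (simp add: bij_betw_def)
    ultimately have d: "(step ^^ d) x = x"
      using x by (auto dest: inj_onD)
    have "d dvd fact (card S)"
      using ij by (intro dvd_fact) (auto simp: d_def)
    then obtain q where q: "fact (card S) = d * q"
      by (auto elim: dvdE)
    have "(step ^^ (d * k)) x = x" for k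
      by (induction k) (simp_all add: d funpow_add)
    then show ?thesis
      unfolding q by simp
  qed
  then show ?thesis
    using that [of "fact (card S)"] by simp
qed

text \<open>An orbit that never meets a fringe vertex reads a power of a band. Any other is
  reflected at both ends of a route and reads this route and its inverse alternately. That all
  substrings of the trail lift is what compatibility will need.\<close>

lemma orbit_trail:
  assumes m: "m > 0" "\<And>x. x \<in> S \<Longrightarrow> (step ^^ m) x = x" and x: "x \<in> S"
  shows "\<exists>T c. T \<in> trails G \<and> 0 \<le> c \<and> (\<forall>s\<in>substrings G T. lifted s) \<and>
    (\<forall>e. real (count_list (map fst (word x m)) e) = c * trail_vec T e)"
proof (cases "\<forall>k. internal (other_half (fst ((step ^^ k) x)))")
  case True
  define w where "w = word x m"
  have "w \<noteq> []"
    using m(1) by (auto simp: w_def word_def)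
  then obtain B r where B: "w = string_power B r" "B \<noteq> []" "r \<noteq> 0"
    "\<And>s k. B = string_power s k \<Longrightarrow> k < 2"
    using primitive_root by blast
  \<comment> \<open>All powers are needed, since the substrings of a band are taken from arbitrary
    powers.\<close>
  have lifted: "lifted (string_power B k)" for k
  proof (rule lifted_sublist)
    show "lifted (string_power w k)"
      using True x word_period [OF m(2) [OF x]] by (simp add: w_def lifted_word)
    have "k \<le> r * k"
      using B(3) by simp
    then have "string_power w k = string_power B k @ string_power B (r * k - k)"
      by (simp add: B(1) string_power_mult flip: string_power_add)
    then show "sublist (string_power B k) (string_power w k)"
      by simp
  qed
  have "is_string G (string_power B 2)"
    using lifted lifted_is_string by blast
  then have band: "is_band G B"
    using B(2,4) by (fastforce simp: is_band_def numeral_2_eq_2)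
  have T: "rotations B \<in> trails G"
    using band by (auto simp: trails_def bands_def rotations_def)
  have "lifted s" if "s \<in> substrings G (rotations B)" for s
  proof -
    have "\<exists>p\<in>rotations B. sublist s p \<or> (\<exists>k. sublist s (string_power p k))"
      using that unfolding substrings_def by blast
    moreover have "string_power p 1 = p" for p :: "'e oriented_edge list"
      by simp
    ultimately obtain p k where p: "p \<in> rotations B" "sublist s (string_power p k)"
      by metis
    from p(1) obtain n where "p = rotate n B \<or> p = rotate n (inv_string B)"
      unfolding rotations_def by blast
    then have "sublist (string_power p k) (string_power B (Suc k)) \<or>
        sublist (string_power p k) (inv_string (string_power B (Suc k)))"
      unfolding inv_string_power using sublist_power_rotate by blast
    then show ?thesis
      using lifted [of "Suc k"] lifted_inv_string [OF lifted [of "Suc k"]] p(2) lifted_sublist by blast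
  qed
  moreover have "real (count_list (map fst (word x m)) e) = real r * trail_vec (rotations B) e" for e
    using trail_vec_eq [OF T rotations_self]
    by (simp add: B(1) map_string_power count_list_string_power flip: w_def)
  ultimately show ?thesis
    using T of_nat_0_le_iff by blast
next
  case False
  then obtain k where k: "\<not> internal (other_half (fst ((step ^^ k) x)))"
    by blast
  define z where "z = (step ^^ k) x"
  define y where "y = flip z"
  have zS: "z \<in> S" and yS: "y \<in> S"
    using x by (simp_all add: z_def y_def)
  have zy: "step z = y"
    using step_fringe [OF zS] k by (simp add: y_def z_def)
  \<comment> \<open>The period brings \<open>y\<close> back to \<open>z\<close>, whose head is at
    the fringe. So the motion from \<open>y\<close> meets a fringe vertex, and a first such time
    exists.\<close>
  have "(step ^^ Suc (m - 1)) z = (step ^^ (m - 1)) y"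
    by (simp only: funpow_Suc_right comp_apply zy)
  then have "(step ^^ (m - 1)) y = z"
    using m(2) [OF zS] m(1) by simp
  then have ex: "\<exists>n. \<not> internal (other_half (fst ((step ^^ n) y)))"
    using k z_def by metis
  define n where "n = (LEAST n. \<not> internal (other_half (fst ((step ^^ n) y))))"
  have n: "\<not> internal (other_half (fst ((step ^^ n) y)))"
    unfolding n_def using ex by (rule LeastI_ex)
  have less_n: "internal (other_half (fst ((step ^^ j) y)))" if "j < n" for j
    using not_less_Least that unfolding n_def by blast
  define p where "p = word y (Suc n)"
  have lifted: "lifted p"
    unfolding p_def using yS less_n by (intro lifted_word) auto
  have len_p: "length p = Suc n"
    by (simp add: p_def)
  have nth_p: "p ! j = fst ((step ^^ j) y)" if "j \<le> n" for j
    using that by (simp add: p_def word_def del: upt_Suc)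
  have "p \<noteq> []"
    using len_p by auto
  then have p: "p \<noteq> []" "hd p = fst y" "last p = fst ((step ^^ n) y)"
    using nth_p [of 0] nth_p [of n] len_p by (simp_all add: hd_conv_nth last_conv_nth)
  have "is_route G p"
  proof -
    have "fst y \<in> half_edges G" "other_half (fst ((step ^^ n) y)) \<in> half_edges G"
      using yS funpow_step_in [OF yS, of n] by (simp_all add: in_strands)
    moreover have "\<not> internal (fst y)"
      using k by (simp add: y_def z_def)
    ultimately show ?thesis
      using n p lifted_is_string [OF lifted] internal_iff by (simp add: is_route_def)
  qed
  define T where "T = {p, inv_string p}"
  have T: "T \<in> trails G"
    using \<open>is_route G p\<close> by (auto simp: trails_def routes_def T_def)
  have "lifted s" if "s \<in> substrings G T" for s
  proof -
    have "is_route G q \<and> lifted q" if "q \<in> T" for q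
      using that lifted lifted_inv_string \<open>is_route G p\<close> is_route_inv by (auto simp: T_def)
    then show ?thesis
      using that is_band_not_route lifted_sublist unfolding substrings_def by blast
  qed
  moreover have "\<exists>c\<ge>0. \<forall>e. real (count_list (map fst (word x m)) e) = c * trail_vec T e"
  proof -
    define u where "u = (step ^^ n) y"
    have uS: "u \<in> S"
      using yS by (simp add: u_def)
    \<comment> \<open>After reflection at the far end the strand retraces its way,
      \<open>flip\<close> turning time around.\<close>
    have reverse: "(step ^^ j) (flip u) = flip ((step ^^ (n - j)) y)" if "j \<le> n" for j
      using that
    proof (induction j)
      case (Suc j)
      then have "n - j = Suc (n - Suc j)"
        by simp
      then have "(step ^^ (n - j)) y = step ((step ^^ (n - Suc j)) y)"
        by simp
      then show ?case
        using Suc yS by (simp add: step_flip_step)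
    qed (simp add: u_def)
    have step_u: "step u = flip u"
      using step_fringe [OF uS] n by (simp add: u_def)
    have "(step ^^ Suc n) y = flip u"
      using step_u by (simp add: u_def)
    moreover have "word (flip u) (Suc n) = inv_string p"
    proof (rule nth_equalityI)
      fix j assume "j < length (word (flip u) (Suc n))"
      then have "j \<le> n"
        by simp
      then show "word (flip u) (Suc n) ! j = inv_string p ! j"
        using reverse [of j]
        by (simp add: word_def p_def inv_string_def rev_nth nth_append del: upt_Suc)
    qed (simp add: p_def)
    ultimately have w: "word y (Suc n + Suc n) = p @ inv_string p"
      by (simp only: word_add p_def)
    have "(step ^^ Suc n) (flip u) = y"
      using reverse [of n] yS zy zS by (simp add: y_def)
    then have per: "(step ^^ (Suc n + Suc n)) y = y"
      using \<open>(step ^^ Suc n) y = flip u\<close> by (simp only: funpow_add comp_apply)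
    define q where "q = Suc n + Suc n"
    \<comment> \<open>Both \<open>m\<close> and \<open>q\<close> are return times of
      \<open>y\<close>, so the word of length \<open>m * q\<close> is a power of either word;
      comparing counts avoids relating \<open>m\<close> and \<open>q\<close> by divisibility. The
      factor 2 stands for \<open>p\<close> and its inverse.\<close>
    have count: "q * count_list (map fst (word x m)) e = m * (2 * count_list (map fst p) e)" for e
    proof -
      have "count_list (map fst (word ((step ^^ j) x) m)) e = count_list (map fst (word x m)) e" for j
        using word_step m(2) x by (induction j) simp_all
      from this [of "Suc k"] have "count_list (map fst (word x m)) e = count_list (map fst (word y m)) e"
        using zy by (simp add: z_def)
      moreover have "string_power (word y m) q = string_power (word y q) m"
        unfolding q_def word_period [OF m(2) [OF yS]] word_period [OF per] by (simp only: mult.commute)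
      then have "q * count_list (map fst (word y m)) e = m * count_list (map fst (word y q)) e"
        by (metis count_list_string_power map_string_power)
      moreover have "count_list (map fst (inv_string p)) e = count_list (map fst p) e"
        by (simp add: inv_string_def o_def flip: rev_map)
      ultimately show ?thesis
        by (simp add: w [folded q_def])
    qed
    have "real (count_list (map fst (word x m)) e) = 2 * real m / real q * trail_vec T e" for e
    proof -
      have "real q * real (count_list (map fst (word x m)) e) = real m * (2 * real (count_list (map fst p) e))"
        using count [of e] by (metis of_nat_mult of_nat_numeral)
      moreover have "trail_vec T e = real (count_list (map fst p) e)"
        using trail_vec_eq [OF T] by (simp add: T_def)
      moreover have "real q > 0"
        by (simp add: q_def)
      ultimately show ?thesis
        by (simp add: field_simps)
    qed
    then show ?thesis
      by (intro exI [of _ "2 * real m / real q"]) simp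
  qed
  ultimately show ?thesis
    using T by blast
qed

lemma sum_strands: "(\<Sum>x\<in>S. of_bool (fst (fst x) = e)) = (if e \<in> edges G then 2 * real (F e) else 0)"
proof -
  have "(\<Sum>x\<in>S. of_bool (fst (fst x) = e)) = (\<Sum>h\<in>half_edges G. \<Sum>i<F (fst h). of_bool (fst h = e) :: real)"
    unfolding strands_def by (subst sum.Sigma) (simp_all add: split_def del: sum_of_bool_eq)
  also have "\<dots> = (\<Sum>h\<in>half_edges G. if fst h = e then real (F e) else 0)"
    by (intro sum.cong) auto
  also have "\<dots> = (\<Sum>e'\<in>edges G. \<Sum>b\<in>(UNIV :: bool set). if e' = e then real (F e) else 0)"
    unfolding half_edges_def sum.cartesian_product by (simp only: split_def)
  also have "\<dots> = (\<Sum>e'\<in>edges G. if e' = e then 2 * real (F e) else 0)"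
    by (intro sum.cong) (simp_all add: UNIV_bool)
  also have "\<dots> = (if e \<in> edges G then 2 * real (F e) else 0)"
    using chart by (simp add: turbulence_chart_def)
  finally show ?thesis .
qed

text \<open>Every power of \<open>step\<close> permutes the strands, so all \<open>m\<close> times
  contribute alike; the factor 2 stands for the two half-edges of an edge.\<close>

lemma sum_words:
  assumes "e \<in> edges G"
  shows "(\<Sum>x\<in>S. real (count_list (map fst (word x m)) e)) = 2 * real m * real (F e)"
proof -
  have "real (count_list (map fst (word x m)) e) = (\<Sum>k<m. of_bool (fst (fst ((step ^^ k) x)) = e))" for x
    unfolding count_list_conv_sum by (simp add: word_def)
  then have "(\<Sum>x\<in>S. real (count_list (map fst (word x m)) e))
      = (\<Sum>k<m. \<Sum>x\<in>S. of_bool (fst (fst ((step ^^ k) x)) = e))"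
    by (simp only:) (rule sum.swap)
  also have "\<dots> = (\<Sum>k<m. \<Sum>x\<in>S. of_bool (fst (fst x) = e))"
    by (intro sum.cong refl sum.reindex_bij_betw bij_betw_funpow bij_step)
  finally show ?thesis
    using assms by (simp add: sum_strands del: sum_of_bool_eq)
qed

lemma trail_vec_outside:
  assumes "T \<in> trails G" "e \<notin> edges G"
  shows "trail_vec T e = 0"
proof -
  have "is_string G (rep T)"
    using trail_word_string trail_word_rep assms(1) by blast
  then have "e \<notin> set (map fst (rep T))"
    using assms(2) by (auto simp: is_string_def half_edges_def)
  then show ?thesis
    using trail_vec_eq [OF assms(1) rep_in [OF assms(1)]] by (simp add: count_list_0_iff)
qed

lemma strands_represent:
  assumes "\<And>e. e \<notin> edges G \<Longrightarrow> F e = 0"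
  shows "\<exists>K a. represents G R K a (\<lambda>e. real (F e))"
proof -
  obtain m where m: "m > 0" "\<And>x. x \<in> S \<Longrightarrow> (step ^^ m) x = x"
    using period_exists by blast
  obtain T c where T: "\<And>x. x \<in> S \<Longrightarrow> T x \<in> trails G" and c: "\<And>x. x \<in> S \<Longrightarrow> 0 \<le> c x"
    and lifted: "\<And>x s. x \<in> S \<Longrightarrow> s \<in> substrings G (T x) \<Longrightarrow> lifted s"
    and count: "\<And>x e. x \<in> S \<Longrightarrow> real (count_list (map fst (word x m)) e) = c x * trail_vec (T x) e"
    using orbit_trail [OF m] by metis
  \<comment> \<open>Strands that yield the same trail are collected, and division by
    \<open>2 * real m\<close> undoes the \<open>m\<close> steps and the two orientations in which
    each strand is listed.\<close>
  define a where "a U = (\<Sum>x\<in>{x \<in> S. T x = U}. c x / (2 * real m))" for U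
  have "real (F e) = (\<Sum>U\<in>{U \<in> T ` S. a U \<noteq> 0}. a U * trail_vec U e)" for e
  proof -
    have "(\<Sum>U\<in>{U \<in> T ` S. a U \<noteq> 0}. a U * trail_vec U e) = (\<Sum>U\<in>T ` S. a U * trail_vec U e)"
      using finite_S by (intro sum.mono_neutral_left) auto
    also have "\<dots> = (\<Sum>U\<in>T ` S. \<Sum>x\<in>{x \<in> S. T x = U}. c x / (2 * real m) * trail_vec (T x) e)"
      by (intro sum.cong refl) (simp add: a_def sum_distrib_right)
    also have "\<dots> = (\<Sum>x\<in>S. c x / (2 * real m) * trail_vec (T x) e)"
      using finite_S by (rule sum.image_gen [symmetric])
    also have "\<dots> = (\<Sum>x\<in>S. real (count_list (map fst (word x m)) e)) / (2 * real m)"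
      unfolding sum_divide_distrib by (intro sum.cong refl) (simp add: count)
    also have "\<dots> = real (F e)"
    proof (cases "e \<in> edges G")
      case True
      then show ?thesis
        using m(1) by (simp add: sum_words)
    next
      case False
      then show ?thesis
        using assms T trail_vec_outside by (simp add: count)
    qed
    finally show ?thesis ..
  qed
  moreover have "is_bundle G R (T ` S)"
    using T lifted lifted_compatible unfolding is_bundle_def incompatible_def by blast
  moreover have "\<forall>U\<in>T ` S. 0 \<le> a U"
    using c by (auto simp: a_def intro!: sum_nonneg)
  ultimately have "represents G R (T ` S) a (\<lambda>e. real (F e))"
    using finite_S unfolding represents_def by auto
  then show ?thesis
    by blast
qed

end

context framed_chart
begin

lemma nat_flow_represents:
  assumes "flow G (\<lambda>e. real (F e))"
  shows "\<exists>K a. represents G R K a (\<lambda>e. real (F e))"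
proof -
  obtain c where c: "\<And>v x. internal_vertex G v \<Longrightarrow> x \<in> strands F (half_edges_at G v) \<Longrightarrow>
      c v x \<in> strands F (opposite (fst x)) \<and> c v (c v x) = x \<and>
      (\<forall>y\<in>strands F (half_edges_at G v). strand_less x y \<longrightarrow> strand_less (c v y) (c v x))"
    using crossing_at_vertex [OF assms] by metis
  define cross where "cross x = (if internal (fst x) then c (vertex_of G (fst x)) x else x)" for x
  have at: "x \<in> strands F (half_edges_at G (vertex_of G (fst x)))" if "x \<in> strands F (half_edges G)" for x
    using that by (simp add: in_strands half_edges_at_def)
  interpret crossing G R F cross
  proof
    fix x assume x: "x \<in> strands F (half_edges G)"
    show "\<not> internal (fst x) \<Longrightarrow> cross x = x"
      by (simp add: cross_def)
    show opp: "cross x \<in> strands F (opposite (fst x))" if "internal (fst x)"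
      using c [OF _ at [OF x]] that by (simp add: cross_def internal_def)
    show "cross (cross x) = x"
    proof (cases "internal (fst x)")
      case True
      have "fst (cross x) \<in> opposite (fst x)"
        using opp [OF True] by (simp add: in_strands)
      then have "vertex_of G (fst (cross x)) = vertex_of G (fst x)" "internal (fst (cross x))"
        using vertex_opposite internal_opposite True by blast+
      then have "cross (cross x) = c (vertex_of G (fst x)) (c (vertex_of G (fst x)) x)"
        using True by (simp add: cross_def)
      also have "\<dots> = x"
        using c [OF _ at [OF x]] True by (simp add: internal_def)
      finally show ?thesis .
    qed (simp add: cross_def)
    fix y assume y: "y \<in> strands F (half_edges G)" and int: "internal (fst x)" and less: "strand_less x y"
    \<comment> \<open>Comparable strands sit at the same vertex, so one and the same local matching
      applies to both.\<close>
    have "vertex_of G (fst y) = vertex_of G (fst x)"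
    proof (cases "fst x = fst y")
      case False
      then have *: "frame_less G R (fst x) (fst y)"
        using less by (simp add: strand_less_def)
      have "fst x \<in> half_edges G"
        using x by (simp add: in_strands)
      note cls = class_of [OF this int]
      have "fst y \<in> vsim G (vertex_of G (fst x)) `` {fst x}"
        by (rule frame_less_same_class(2) [OF * int [unfolded internal_def] cls(1) disjI1 [OF cls(2)]])
      then show ?thesis
        using equiv_vsim [of "vertex_of G (fst x)"] int
        by (auto simp: internal_def equiv_def half_edges_at_def)
    qed simp
    then show "strand_less (cross y) (cross x)"
      using c [OF _ at [OF x]] at [OF y] int less by (simp add: cross_def internal_def)
  qed
  show ?thesis
    using strands_represent assms by (simp add: flow_def)
qed

end

section \<open>Rational approximation\<close>

lemma common_denominator:
  assumes "finite A" "\<And>x. x \<in> A \<Longrightarrow> x \<in> \<rat>"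
  shows "\<exists>q>0. \<forall>x\<in>A. real q * x \<in> \<int>"
  using assms
proof (induction A rule: finite_induct)
  case (insert x A)
  then obtain q where q: "q > 0" "\<forall>x\<in>A. real q * x \<in> \<int>"
    by blast
  obtain a b where ab: "b > 0" "x = of_int a / of_int b"
    using insert.prems [of x] by (auto elim: Rats_cases')
  have "real (nat b * q) * y \<in> \<int>" if "y \<in> insert x A" for y
  proof (cases "y = x")
    case True
    have "real (nat b * q) * x = of_int (int q * a)"
      using ab by simp
    then show ?thesis
      unfolding True by (simp only: Ints_of_int)
  next
    case False
    then have "real q * y \<in> \<int>"
      using q that by blast
    then have "real (nat b) * (real q * y) \<in> \<int>"
      using Ints_mult [OF Ints_of_nat] by blast
    then show ?thesis
      by (simp only: of_nat_mult mult.assoc)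
  qed
  then show ?case
    using q(1) ab(1) by (intro exI [of _ "nat b * q"]) simp
qed auto

context framed_chart
begin

lemma finite_edges: "finite (edges G)"
  using chart by (simp add: turbulence_chart_def)

lemma flow_scale:
  assumes "flow G F"
  shows "flow G (\<lambda>e. c * F e)"
  unfolding flow_def sum_distrib_left [symmetric]
proof (intro conjI allI impI ballI)
  fix v A B assume "internal_vertex G v" "A \<in> vclasses G v" "B \<in> vclasses G v"
  then have "(\<Sum>h\<in>A. F (fst h)) = (\<Sum>h\<in>B. F (fst h))"
    using assms unfolding flow_def by blast
  then show "c * (\<Sum>h\<in>A. F (fst h)) = c * (\<Sum>h\<in>B. F (fst h))"
    by (rule arg_cong)
qed (use assms in \<open>simp add: flow_def\<close>)

lemma represents_scale:
  assumes "represents G R K a F" "c > 0"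
  shows "represents G R K (\<lambda>T. c * a T) (\<lambda>e. c * F e)"
  using assms unfolding represents_def by (auto simp: sum_distrib_left mult.assoc)

text \<open>Clearing denominators turns the flow into one with natural values, and scaling back
  keeps the bundle.\<close>

lemma rational_flow_represents:
  assumes F: "F \<in> nonneg_flows G" and rat: "\<forall>e\<in>edges G. F e \<in> \<rat>"
  shows "bundle_combination G R F"
proof -
  have flow: "flow G F" and nonneg: "\<And>e. e \<in> edges G \<Longrightarrow> 0 \<le> F e"
    using F by (simp_all add: nonneg_flows_def)
  then have out: "\<And>e. e \<notin> edges G \<Longrightarrow> F e = 0"
    by (simp add: flow_def)
  obtain q where q: "q > 0" "\<forall>x\<in>F ` edges G. real q * x \<in> \<int>"
    using common_denominator [of "F ` edges G"] finite_edges rat by blast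
  define H where "H e = nat \<lfloor>real q * F e\<rfloor>" for e
  have H: "real (H e) = real q * F e" for e
  proof (cases "e \<in> edges G")
    case True
    then have "real q * F e \<in> \<int>" "0 \<le> real q * F e"
      using q nonneg by auto
    then show ?thesis
      by (simp add: H_def)
  qed (simp add: H_def out)
  have "flow G (\<lambda>e. real (H e))"
    unfolding H using flow by (rule flow_scale)
  then obtain K a where "represents G R K a (\<lambda>e. real (H e))"
    using nat_flow_represents by blast
  then have "represents G R K (\<lambda>T. 1 / real q * a T) (\<lambda>e. 1 / real q * real (H e))"
    using q(1) by (intro represents_scale) auto
  moreover have "(\<lambda>e. 1 / real q * real (H e)) = F"
    using q(1) by (simp add: H)
  ultimately show ?thesis
    unfolding bundle_combination_def by auto
qed

text \<open>
  Simultaneous Diophantine approximation preserves every integral linear relation between the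
  approximated numbers as soon as the error is small enough, hence also the flow equations.
\<close>

lemma rational_flow_approx:
  assumes F: "F \<in> nonneg_flows G" and N: "N > 0"
  obtains F' where "F' \<in> nonneg_flows G" "\<forall>e\<in>edges G. F' e \<in> \<rat>" "\<And>e. \<bar>F' e - F e\<bar> \<le> 1 / real N"
proof -
  have flow: "flow G F" and nonneg: "\<And>e. e \<in> edges G \<Longrightarrow> 0 \<le> F e"
    using F by (simp_all add: nonneg_flows_def)
  then have out: "\<And>e. e \<notin> edges G \<Longrightarrow> F e = 0"
    by (simp add: flow_def)
  \<comment> \<open>\<open>M\<close> is at least \<open>N\<close> for the accuracy, and exceeds
    twice the number of half-edges so that the accumulated errors in a flow equation stay below
    1.\<close>
  define M where "M = N * (2 * card (half_edges G) + 1)"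
  have M: "M > 0" "M \<ge> N" "2 * card (half_edges G) < M"
    using N by (cases N; simp add: M_def)+
  obtain f where f: "bij_betw f {0..<card (edges G)} (edges G)"
    using ex_bij_betw_nat_finite [OF finite_edges] by blast
  obtain q p where q: "0 < q"
    and p: "\<And>i. i < card (edges G) \<Longrightarrow> \<bar>of_int q * F (f i) - of_int (p i)\<bar> < 1 / real M"
    using Dirichlet_approx_simult [OF M(1), of "card (edges G)" "F \<circ> f"] by (metis comp_apply)
  define P where "P e = (if e \<in> edges G then p (inv_into {0..<card (edges G)} f e) else 0)" for e
  have P: "\<bar>of_int q * F e - of_int (P e)\<bar> < 1 / real M" for e
  proof (cases "e \<in> edges G")
    case True
    then have "e \<in> f ` {0..<card (edges G)}"
      using f by (simp add: bij_betw_def)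
    then obtain i where i: "i < card (edges G)" "e = f i"
      by auto
    then have "P e = p i"
      using True f by (simp add: P_def bij_betw_def inv_into_f_f)
    then show ?thesis
      using p [OF i(1)] i(2) by simp
  qed (use M(1) in \<open>simp add: P_def out\<close>)
  define F' :: "'e \<Rightarrow> real" where "F' e = of_int (P e) / of_int q" for e
  have "(\<Sum>h\<in>A. F' (fst h)) = (\<Sum>h\<in>B. F' (fst h))"
    if v: "internal_vertex G v" and AB: "A \<in> vclasses G v" "B \<in> vclasses G v" for v A B
  proof -
    have bound: "\<bar>\<Sum>h\<in>C. of_int q * F (fst h) - of_int (P (fst h))\<bar> \<le> real (card (half_edges G)) / real M"
      if C: "C \<in> vclasses G v" for C
    proof -
      have "C \<subseteq> half_edges G"
        using in_quotient_imp_subset [OF equiv_vsim [OF v], of C] C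
        by (auto simp: vclasses_def half_edges_at_def)
      then have "card C \<le> card (half_edges G)"
        by (intro card_mono) simp_all
      have "\<bar>\<Sum>h\<in>C. of_int q * F (fst h) - of_int (P (fst h))\<bar>
          \<le> (\<Sum>h\<in>C. \<bar>of_int q * F (fst h) - of_int (P (fst h))\<bar>)"
        by (rule sum_abs)
      also have "\<dots> \<le> (\<Sum>h\<in>C. 1 / real M)"
        using P by (intro sum_mono) (simp add: less_imp_le)
      also have "\<dots> \<le> real (card (half_edges G)) / real M"
        using \<open>card C \<le> card (half_edges G)\<close> M(1) by (simp add: divide_right_mono)
      finally show ?thesis .
    qed
    have "(\<Sum>h\<in>A. F (fst h)) = (\<Sum>h\<in>B. F (fst h))"
      using flow v AB unfolding flow_def by blast
    \<comment> \<open>\<open>F\<close> satisfies the equation exactly, so the integer defect of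
      \<open>P\<close> is a difference of two error sums. Its absolute value is below 1, hence it
      vanishes.\<close>
    then have "of_int ((\<Sum>h\<in>A. P (fst h)) - (\<Sum>h\<in>B. P (fst h)))
        = (\<Sum>h\<in>B. of_int q * F (fst h) - of_int (P (fst h))) - (\<Sum>h\<in>A. of_int q * F (fst h) - of_int (P (fst h)))"
      by (simp add: sum_subtractf flip: sum_distrib_left)
    then have "\<bar>real_of_int ((\<Sum>h\<in>A. P (fst h)) - (\<Sum>h\<in>B. P (fst h)))\<bar> \<le> 2 * real (card (half_edges G)) / real M"
      using bound [OF AB(1)] bound [OF AB(2)] by linarith
    also have "\<dots> < 1"
      using M by simp
    finally have "(\<Sum>h\<in>A. P (fst h)) = (\<Sum>h\<in>B. P (fst h))"
      by linarith
    then show ?thesis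
      unfolding F'_def sum_divide_distrib [symmetric] of_int_sum [symmetric] by simp
  qed
  moreover have "\<forall>e. e \<notin> edges G \<longrightarrow> F' e = 0"
    by (simp add: F'_def P_def)
  ultimately have "flow G F'"
    unfolding flow_def by blast
  moreover have "0 \<le> F' e" if "e \<in> edges G" for e
  proof -
    have "0 \<le> of_int q * F e"
      using nonneg [OF that] q by simp
    moreover have "1 / real M \<le> 1"
      using M(1) by simp
    \<comment> \<open>An integer above -1 is nonnegative, so the approximation cannot make an edge
      value negative.\<close>
    ultimately have "real_of_int (P e) > -1"
      using P [of e] by linarith
    then have "P e \<ge> 0"
      by linarith
    then show ?thesis
      using q by (simp add: F'_def)
  qed
  moreover have "\<bar>F' e - F e\<bar> \<le> 1 / real N" for e
  proof -
    have "F' e - F e = (of_int (P e) - of_int q * F e) / of_int q"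
      using q by (simp add: F'_def field_simps)
    then have "\<bar>F' e - F e\<bar> = \<bar>of_int q * F e - of_int (P e)\<bar> / of_int q"
      using q by (simp add: abs_minus_commute)
    \<comment> \<open>\<open>q\<close> is at least 1, so dividing by it only shrinks the
      error.\<close>
    also have "\<dots> \<le> \<bar>of_int q * F e - of_int (P e)\<bar> / 1"
      using q by (intro divide_left_mono) auto
    also have "\<dots> \<le> 1 / real M"
      using P [of e] by simp
    also have "\<dots> \<le> 1 / real N"
      using M N by (intro divide_left_mono) auto
    finally show ?thesis .
  qed
  ultimately show ?thesis
    by (intro that [of F']) (auto simp: nonneg_flows_def F'_def)
qed

lemma nonneg_flows_subset_closure:
  "nonneg_flows G \<subseteq> closure {F \<in> nonneg_flows G. bundle_combination G R F}"
proof
  fix F assume F: "F \<in> nonneg_flows G"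
  have "\<exists>F'. F' \<in> nonneg_flows G \<and> bundle_combination G R F' \<and> (\<forall>e. \<bar>F' e - F e\<bar> \<le> 1 / real (Suc k))" for k
    using rational_flow_approx [OF F, of "Suc k"] rational_flow_represents by (metis zero_less_Suc)
  then obtain X where X: "\<And>k. X k \<in> nonneg_flows G" "\<And>k. bundle_combination G R (X k)"
    "\<And>k e. \<bar>X k e - F e\<bar> \<le> 1 / real (Suc k)"
    by metis
  have "(\<lambda>k. X k e) \<longlonglongrightarrow> F e" for e
  proof (rule LIM_zero_cancel, rule Lim_null_comparison)
    show "\<forall>\<^sub>F k in sequentially. norm (X k e - F e) \<le> inverse (real (Suc k))"
      using X(3) by (simp add: inverse_eq_divide)
    show "(\<lambda>k. inverse (real (Suc k))) \<longlonglongrightarrow> 0"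
      by (rule LIMSEQ_inverse_real_of_nat)
  qed
  \<comment> \<open>Functions carry the product topology, so convergence can be checked one edge at
    a time.\<close>
  then have "limitin (product_topology (\<lambda>_. euclidean) UNIV) X F sequentially"
    by (simp add: limitin_componentwise)
  then have lim: "X \<longlonglongrightarrow> F"
    by (simp add: euclidean_product_topology)
  have "X k \<in> closure {F \<in> nonneg_flows G. bundle_combination G R F}" for k
    by (rule subsetD [OF closure_subset]) (simp add: X(1,2))
  then show "F \<in> closure {F \<in> nonneg_flows G. bundle_combination G R F}"
    using Lim_in_closed_set [OF closed_closure always_eventually sequentially_bot lim] by blast
qed

end

declare [[show_abbrevs = true]]

theorem theorem8p12:
  fixes G :: "('v, 'e) chart"
    and R :: "'e half_edge set \<Rightarrow> 'e half_edge rel"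
  assumes "turbulence_chart G" and "framing G R"
  shows
    "(\<forall>F \<in> nonneg_flows G. \<forall>K a L b.
        positively_represents G R K a F \<and> positively_represents G R L b F \<longrightarrow>
        K = L \<and> (\<forall>T \<in> K. a T = b T)) \<and>
     nonneg_flows G \<subseteq> closure {F \<in> nonneg_flows G. bundle_combination G R F} \<and>
     (\<forall>F \<in> nonneg_flows G. (\<forall>e \<in> edges G. F e \<in> \<rat>) \<longrightarrow> bundle_combination G R F) \<and>
     (\<forall>F \<in> nonneg_flows G. (\<forall>e \<in> edges G. F e \<in> \<int>) \<longrightarrow>
        (\<forall>K a. represents G R K a F \<longrightarrow> (\<forall>T \<in> K. a T \<in> \<int>)))"
proof -
  interpret framed_chart G R
    by unfold_locales fact+
  show ?thesis
  proof (intro conjI ballI allI impI)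
    fix F K a L b
    assume *: "positively_represents G R K a F \<and> positively_represents G R L b F"
    then show "K = L"
      using represents_unique(1) by blast
    show "a T = b T" if "T \<in> K" for T
      using represents_unique(2) * that by blast
  next
    show "nonneg_flows G \<subseteq> closure {F \<in> nonneg_flows G. bundle_combination G R F}"
      by (rule nonneg_flows_subset_closure)
  next
    fix F assume "F \<in> nonneg_flows G" "\<forall>e\<in>edges G. F e \<in> \<rat>"
    then show "bundle_combination G R F"
      by (rule rational_flow_represents)
  next
    fix F K a T assume "\<forall>e\<in>edges G. F e \<in> \<int>" "represents G R K a F" "T \<in> K"
    then show "a T \<in> \<int>"
      using represents_Ints by blast
  qed
qed

end
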